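(* Let $\epsilon\in(0,1]$ be fixed. Consider the order-free version of AdaR-ETC (defined in the context; it uses neither $\epsilon$ nor $u$). (1) There exist constants $C,m>0$, depending only on $\epsilon$, such that for every $u>0$, all $T\ge K\ge2$ and every instance $\underline\nu\in\mathcal H_{\epsilon,u}$, $$R_T(\underline\nu)\ \le\ C\,\big(1+\log(KT)\big)^m\,u^{\frac1{1+\epsilon}}\,K^{\frac{2\epsilon}{3(1+\epsilon)}}\,T^{\frac{3+\epsilon}{3(1+\epsilon)}}.$$ (2) For every $u>0$, every $K\ge2$ and every fixed instance $\underline\nu\in\mathcal H_{\epsilon,u}$, $$\limsup_{T\to+\infty}\frac{R_T(\underline\nu)}{K^{-2/3}T^{2/3}}\ \le\ \sum_{i:\Delta_i>0}\Delta_i .$$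
   Context: Bandit model. There are $K\ge 2$ arms and a horizon of $T\ge1$ rounds. An instance is a tuple $\underline\nu=(\nu_1,\dots,\nu_K)$ of probability distributions on $\mathbb R$. Successive pulls of arm $i$ produce i.i.d. rewards from $\nu_i$, independently across arms. At each round $t$ the learner picks an arm $I_t\in\{1,\dots,K\}$ based on the past and observes a reward of that arm. For $\epsilon\in(0,1]$, $u>0$, $$\mathcal H_{\epsilon,u}=\{(\nu_1,\dots,\nu_K):\ \mathbb E_{X\sim\nu_i}[|X|^{1+\epsilon}]\le u\ \text{ for all } i\}.$$ With $\mu_i=\mathbb E_{X\sim\nu_i}[X]$, $\mu^*=\max_i\mu_i$, $\Delta_i=\mu^*-\mu_i$, the expected regret is $R_T(\underline\nu)=\mathbb E\big[\sum_{t=1}^T(\mu^*-\mu_{I_t})\big]$. Order-free AdaR-ETC (calibrated to $\epsilon=1$). Inputs: $K,T$ only. Set $$B_T=\lceil 8\log(KT^3)\rceil,\quad \widetilde L_T=KB_T+\lceil K^{1/3}T^{2/3}\rceil,\quad L_T=\min\{T,\widetilde L_T\}.$$ Exploration: for $t=1,\dots,L_T$ play $I_t=1+((t-1)\bmod K)$. Commitment: if $L_T<T$, compute for each arm $i$ the Median-of-Means estimate $\widehat\mu_i^{MoM}$ from its $n_i$ exploration samples, choose $\widehat I^*\in\arg\max_i\widehat\mu_i^{MoM}$, and play $I_t=\widehat I^*$ for $t=L_T+1,\dots,T$. Median-of-Means estimate: given samples $X_{i,1},\dots,X_{i,n_i}$, let $s_i=\lfloor n_i/B_T\rfloor$, form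 the $B_T$ block averages $\overline X_{i,b}=\frac1{s_i}\sum_{\ell=(b-1)s_i+1}^{bs_i}X_{i,\ell}$, $b=1,\dots,B_T$ (leftover samples are discarded), and let $\widehat\mu_i^{MoM}$ be the $\lceil B_T/2\rceil$-th smallest block average. *)

theory Defs
  imports "HOL-Probability.Probability"
begin

text \<open>Instances with arms \<open>1, \<dots>, K\<close>; the values of \<open>\<nu>\<close> outside \<open>{1..K}\<close> are irrelevant.
  The moment is a nonnegative integral, so the bound forces it to be finite.\<close>

definition heavy_tailed :: "real \<Rightarrow> real \<Rightarrow> nat \<Rightarrow> (nat \<Rightarrow> real measure) set" where
  "heavy_tailed \<epsilon> u K = {\<nu>. \<forall>i\<in>{1..K}. prob_space (\<nu> i) \<and> sets (\<nu> i) = sets borel \<and>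
     (\<integral>\<^sup>+ x. ennreal (\<bar>x\<bar> powr (1 + \<epsilon>)) \<partial>\<nu> i) \<le> ennreal u}"

definition arm_mean :: "(nat \<Rightarrow> real measure) \<Rightarrow> nat \<Rightarrow> real" where
  "arm_mean \<nu> i = (\<integral>x. x \<partial>\<nu> i)"

definition best_mean :: "nat \<Rightarrow> (nat \<Rightarrow> real measure) \<Rightarrow> real" where
  "best_mean K \<nu> = Max (arm_mean \<nu> ` {1..K})"

definition gap :: "nat \<Rightarrow> (nat \<Rightarrow> real measure) \<Rightarrow> nat \<Rightarrow> real" where
  "gap K \<nu> i = best_mean K \<nu> - arm_mean \<nu> i"

text \<open>A history lists the pairs (arm, observed reward) in chronological order. A policy maps
  a random seed and the history to the next arm; a deterministic policy ignores the seed.\<close>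

type_synonym history = "(nat \<times> real) list"
type_synonym policy = "real \<Rightarrow> history \<Rightarrow> nat"

definition samples :: "nat \<Rightarrow> history \<Rightarrow> real list" where
  "samples i h = map snd (filter (\<lambda>p. fst p = i) h)"

text \<open>In a reward table \<open>x\<close>, the entry \<open>x (i, s)\<close> is the reward of the pull of arm \<open>i\<close>
  that follows \<open>s\<close> earlier pulls of arm \<open>i\<close>.\<close>

primrec play :: "policy \<Rightarrow> real \<Rightarrow> (nat \<times> nat \<Rightarrow> real) \<Rightarrow> nat \<Rightarrow> history" where
  "play \<pi> w x 0 = []"
| "play \<pi> w x (Suc t) = (let h = play \<pi> w x t; i = \<pi> w h in h @ [(i, x (i, length (samples i h)))])"

definition arm_at :: "policy \<Rightarrow> real \<Rightarrow> (nat \<times> nat \<Rightarrow> real) \<Rightarrow> nat \<Rightarrow> nat" where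
  "arm_at \<pi> w x t = \<pi> w (play \<pi> w x (t - 1))"

definition bandit_space :: "nat \<Rightarrow> (nat \<Rightarrow> real measure) \<Rightarrow> (real \<times> (nat \<times> nat \<Rightarrow> real)) measure" where
  "bandit_space K \<nu> =
     uniform_measure lborel {0..1} \<Otimes>\<^sub>M (\<Pi>\<^sub>M p\<in>{1..K} \<times> UNIV. \<nu> (fst p))"

definition regret :: "nat \<Rightarrow> nat \<Rightarrow> (nat \<Rightarrow> real measure) \<Rightarrow> policy \<Rightarrow> real" where
  "regret K T \<nu> \<pi> =
     (\<integral>\<omega>. (\<Sum>t=1..T. best_mean K \<nu> - arm_mean \<nu> (arm_at \<pi> (fst \<omega>) (snd \<omega>) t)) \<partial>bandit_space K \<nu>)"

text \<open>Measurability in the seed and the observed rewards, for every fixed sequence of arms.\<close>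

definition measurable_policy :: "policy \<Rightarrow> bool" where
  "measurable_policy \<pi> \<longleftrightarrow>
     (\<forall>js. (\<lambda>(w, r). \<pi> w (zip js (map r [0..<length js])))
        \<in> borel \<Otimes>\<^sub>M (\<Pi>\<^sub>M k\<in>{..<length js}. (borel :: real measure)) \<rightarrow>\<^sub>M count_space UNIV)"

text \<open>Blocks are indexed from \<open>0\<close>, and \<open>!\<close> counts from \<open>0\<close>.\<close>

definition block_mean :: "nat \<Rightarrow> real list \<Rightarrow> nat \<Rightarrow> real" where
  "block_mean B xs b = (let s = length xs div B in (\<Sum>l = b * s..<(b + 1) * s. xs ! l) / real s)"

definition median_of_means :: "nat \<Rightarrow> real list \<Rightarrow> real" where
  "median_of_means B xs = sort (map (block_mean B xs) [0..<B]) ! (nat \<lceil>real B / 2\<rceil> - 1)"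

definition num_blocks :: "nat \<Rightarrow> nat \<Rightarrow> nat" where
  "num_blocks K T = nat \<lceil>8 * ln (real K * real T ^ 3)\<rceil>"

definition explore_length :: "nat \<Rightarrow> nat \<Rightarrow> nat" where
  "explore_length K T =
     min T (K * num_blocks K T + nat \<lceil>real K powr (1/3) * real T powr (2/3)\<rceil>)"

text \<open>The policies that implement order-free AdaR-ETC: they differ only in how ties in the
  argmax are broken, which may depend on the seed and on the exploration history. The
  arm chosen after exploration is kept until the horizon.\<close>

definition adar_etc :: "nat \<Rightarrow> nat \<Rightarrow> policy \<Rightarrow> bool" where
  "adar_etc K T \<pi> \<longleftrightarrow> measurable_policy \<pi> \<and>
     (\<forall>w h. length h < explore_length K T \<longrightarrow> \<pi> w h = 1 + length h mod K) \<and>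
     (\<forall>w h. explore_length K T \<le> length h \<and> length h < T \<longrightarrow>
        (let e = take (explore_length K T) h;
             est = (\<lambda>i. median_of_means (num_blocks K T) (samples i e))
         in \<pi> w h = \<pi> w e \<and> \<pi> w h \<in> {1..K} \<and> (\<forall>j\<in>{1..K}. est j \<le> est (\<pi> w h))))"

end

theory Submission
  imports Defs "HOL-Real_Asymp.Real_Asymp"
begin

text \<open>A truncation argument bounds the probability that the mean of \<open>s\<close> samples is off by more than
  \<open>r\<close> by five times \<open>u * s powr (-\<epsilon>) * r powr (-(1 + \<epsilon>))\<close>. Once this is at most 1/8, the median of
  the block means is off by more than \<open>r\<close> only if half of the independent blocks are, which by a union
  bound over the sets of bad blocks has probability at most \<open>1 / (K * T ^ 3)\<close>. Outside this event
  the committed arm has gap at most \<open>2 * r\<close>. For the first claim \<open>r\<close> is the smallest admissible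
  value, of order \<open>(u / s powr \<epsilon>) powr (1 / (1 + \<epsilon>))\<close> with \<open>s\<close> of order
  \<open>K powr (-2/3) * T powr (2/3)\<close> up to a logarithm. For the second, \<open>r\<close> is fixed below half the
  smallest positive gap, so that only exploration contributes asymptotically.\<close>

section \<open>Means of heavy-tailed samples\<close>

text \<open>Expanding the square gives a double sum whose off-diagonal terms vanish, since
  independence factors them into products of zero means. Integrability comes along because
  Chebyshev's inequality asks for it.\<close>

lemma (in prob_space) expectation_sum_indep_square:
  fixes Z :: "'i \<Rightarrow> 'a \<Rightarrow> real"
  assumes "finite J" and ind: "indep_vars (\<lambda>_. borel) Z J"
    and sq: "\<And>j. j \<in> J \<Longrightarrow> integrable M (\<lambda>x. (Z j x)\<^sup>2)"
    and zero: "\<And>j. j \<in> J \<Longrightarrow> expectation (Z j) = 0"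
  shows "integrable M (\<lambda>x. (\<Sum>j\<in>J. Z j x)\<^sup>2)"
    and "expectation (\<lambda>x. (\<Sum>j\<in>J. Z j x)\<^sup>2) = (\<Sum>j\<in>J. expectation (\<lambda>x. (Z j x)\<^sup>2))"
proof -
  have meas: "Z j \<in> borel_measurable M" if "j \<in> J" for j
    using ind that by (auto simp: indep_vars_def)
  have int: "integrable M (Z j)" if "j \<in> J" for j
    using square_integrable_imp_integrable[OF meas sq] that by blast
  have pair: "integrable M (\<lambda>x. Z j x * Z k x) \<and>
      expectation (\<lambda>x. Z j x * Z k x) = (if j = k then expectation (\<lambda>x. (Z j x)\<^sup>2) else 0)"
    if "j \<in> J" "k \<in> J" for j k
  proof (cases "j = k")
    case True
    then show ?thesis using sq[OF that(1)] by (simp add: power2_eq_square)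
  next
    case False
    have ind2: "indep_vars (\<lambda>_. borel) Z {j, k}"
      using that by (intro indep_vars_subset[OF ind]) auto
    have int2: "integrable M (Z i)" if "i \<in> {j, k}" for i
      using int that \<open>j \<in> J\<close> \<open>k \<in> J\<close> by blast
    show ?thesis
      using indep_vars_lebesgue_integral[OF _ ind2 int2] indep_vars_integrable[OF _ ind2 int2]
        that False by (simp add: zero)
  qed
  have expand: "(\<Sum>j\<in>J. Z j x)\<^sup>2 = (\<Sum>j\<in>J. \<Sum>k\<in>J. Z j x * Z k x)" for x
    by (simp add: power2_eq_square sum_product)
  show "integrable M (\<lambda>x. (\<Sum>j\<in>J. Z j x)\<^sup>2)"
    unfolding expand using pair by (intro Bochner_Integration.integrable_sum) blast
  have "expectation (\<lambda>x. (\<Sum>j\<in>J. Z j x)\<^sup>2) = (\<Sum>j\<in>J. \<Sum>k\<in>J. expectation (\<lambda>x. Z j x * Z k x))"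
    unfolding expand using pair
    by (simp add: Bochner_Integration.integral_sum Bochner_Integration.integrable_sum)
  also have "\<dots> = (\<Sum>j\<in>J. \<Sum>k\<in>J. if j = k then expectation (\<lambda>x. (Z j x)\<^sup>2) else 0)"
    using pair by (intro sum.cong) auto
  finally show "expectation (\<lambda>x. (\<Sum>j\<in>J. Z j x)\<^sup>2) = (\<Sum>j\<in>J. expectation (\<lambda>x. (Z j x)\<^sup>2))"
    using \<open>finite J\<close> by simp
qed

text \<open>Moves the moment bound from the nonnegative integral of \<open>heavy_tailed\<close> to
  the Bochner integral, in which the later expectations are computed.\<close>

lemma (in prob_space) moment_bound:
  fixes X :: "'a \<Rightarrow> real"
  assumes [measurable]: "random_variable borel X" and "0 \<le> u"
    and mom: "(\<integral>\<^sup>+ x. ennreal (\<bar>X x\<bar> powr (1 + \<epsilon>)) \<partial>M) \<le> ennreal u"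
  shows "integrable M (\<lambda>x. \<bar>X x\<bar> powr (1 + \<epsilon>))"
    and "expectation (\<lambda>x. \<bar>X x\<bar> powr (1 + \<epsilon>)) \<le> u"
proof -
  show "integrable M (\<lambda>x. \<bar>X x\<bar> powr (1 + \<epsilon>))"
    using mom by (intro integrableI_bounded) (auto simp: order_le_less_trans)
  show "expectation (\<lambda>x. \<bar>X x\<bar> powr (1 + \<epsilon>)) \<le> u"
    using mom assms(2) by (subst integral_eq_nn_integral) (auto simp: enn2real_leI)
qed

text \<open>Above the level \<open>a\<close> the factor \<open>(\<bar>x\<bar> / a) powr p\<close> is
  at least 1. The bounds below on tail probabilities, truncation bias and means are all
  instances.\<close>

lemma powr_tail:
  fixes x a :: real
  assumes "0 < a" "a \<le> \<bar>x\<bar>" "0 \<le> p"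
  shows "\<bar>x\<bar> powr q \<le> \<bar>x\<bar> powr (q + p) * a powr (-p)"
proof -
  have "a powr p \<le> \<bar>x\<bar> powr p" using assms by (intro powr_mono2) auto
  then have "\<bar>x\<bar> powr q * (a powr p * a powr (-p)) \<le> \<bar>x\<bar> powr q * (\<bar>x\<bar> powr p * a powr (-p))"
    by (intro mult_left_mono mult_right_mono) auto
  moreover have "a powr p * a powr (-p) = 1"
    using assms by (simp add: powr_add[symmetric])
  ultimately show ?thesis by (simp add: powr_add mult.assoc)
qed

lemma (in prob_space) integrable_of_moment:
  fixes X :: "'a \<Rightarrow> real"
  assumes [measurable]: "random_variable borel X" and "0 < \<epsilon>"
    and mom: "integrable M (\<lambda>x. \<bar>X x\<bar> powr (1 + \<epsilon>))"
  shows "integrable M X"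
proof (rule Bochner_Integration.integrable_bound)
  show "integrable M (\<lambda>x. 1 + \<bar>X x\<bar> powr (1 + \<epsilon>))" using mom by simp
  have "\<bar>y\<bar> \<le> 1 + \<bar>y\<bar> powr (1 + \<epsilon>)" for y :: real
    using powr_tail[of 1 y \<epsilon> 1] \<open>0 < \<epsilon>\<close> by (cases "1 \<le> \<bar>y\<bar>") (auto intro: add_increasing2)
  then show "AE x in M. norm (X x) \<le> norm (1 + \<bar>X x\<bar> powr (1 + \<epsilon>))" by auto
qed simp

text \<open>Split at the threshold \<open>v = u powr (1 / (1 + \<epsilon>))\<close>: values below it
  contribute at most \<open>v\<close>, and so does the tail, whence the factor 2.\<close>

lemma (in prob_space) abs_expectation_le_moment:
  fixes X :: "'a \<Rightarrow> real"
  assumes [measurable]: "random_variable borel X" and "0 < \<epsilon>" and "0 < u"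
    and mom: "(\<integral>\<^sup>+ x. ennreal (\<bar>X x\<bar> powr (1 + \<epsilon>)) \<partial>M) \<le> ennreal u"
  shows "\<bar>expectation X\<bar> \<le> 2 * u powr (1 / (1 + \<epsilon>))"
proof -
  define v where "v = u powr (1 / (1 + \<epsilon>))"
  have v: "0 < v" "v powr (1 + \<epsilon>) = u" using assms by (auto simp: v_def powr_powr)
  note m = moment_bound[OF assms(1) less_imp_le[OF \<open>0 < u\<close>] mom]
  have pt: "\<bar>y\<bar> \<le> v + \<bar>y\<bar> powr (1 + \<epsilon>) * v powr (-\<epsilon>)" for y :: real
    using powr_tail[of v y \<epsilon> 1] v \<open>0 < \<epsilon>\<close> by (cases "v \<le> \<bar>y\<bar>") (auto intro: add_increasing2)
  have "\<bar>expectation X\<bar> \<le> expectation (\<lambda>x. \<bar>X x\<bar>)" by (rule integral_abs_bound)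
  also have "\<dots> \<le> expectation (\<lambda>x. v + \<bar>X x\<bar> powr (1 + \<epsilon>) * v powr (-\<epsilon>))"
    using m pt v by (intro integral_mono') (auto intro!: add_nonneg_nonneg mult_nonneg_nonneg)
  also have "\<dots> = v + expectation (\<lambda>x. \<bar>X x\<bar> powr (1 + \<epsilon>)) * v powr (-\<epsilon>)"
    using m by (simp add: prob_space)
  also have "\<dots> \<le> v + v powr (1 + \<epsilon>) * v powr (-\<epsilon>)"
    using m v by (intro add_left_mono mult_right_mono) auto
  also have "\<dots> = 2 * v" using v(1) by (simp add: powr_add[symmetric])
  finally show ?thesis by (simp add: v_def)
qed

text \<open>Truncating at the level \<open>card J * r\<close> balances the probability that some sample is truncated,
  the truncation bias, and the variance of the truncated sum.\<close>

lemma (in prob_space) heavy_tailed_mean_deviation: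
  fixes X :: "'i \<Rightarrow> 'a \<Rightarrow> real"
  assumes J: "finite J" "J \<noteq> {}" and ind: "indep_vars (\<lambda>_. borel) X J"
    and mom: "\<And>j. j \<in> J \<Longrightarrow> (\<integral>\<^sup>+ x. ennreal (\<bar>X j x\<bar> powr (1 + \<epsilon>)) \<partial>M) \<le> ennreal u"
    and mean: "\<And>j. j \<in> J \<Longrightarrow> expectation (X j) = \<mu>"
    and e: "0 < \<epsilon>" "\<epsilon> \<le> 1" and "0 < r" "0 \<le> u"
    and q: "real (card J) * u * (real (card J) * r) powr (- (1 + \<epsilon>)) \<le> 1 / 2"
  shows "prob {x \<in> space M. r < \<bar>(\<Sum>j\<in>J. X j x) / real (card J) - \<mu>\<bar>}
           \<le> 5 * (real (card J) * u * (real (card J) * r) powr (- (1 + \<epsilon>)))"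
proof -
  define S where "S = real (card J)"
  define a where "a = S * r"
  \<comment> \<open>All errors are measured by \<open>Q\<close>: some sample is truncated with
    probability at most \<open>Q\<close>, the total bias is at most \<open>a * Q\<close>, hence at
    most \<open>a / 2\<close>, and Chebyshev at level \<open>a / 2\<close> costs
    \<open>4 * Q\<close>. The 5 is 1 + 4.\<close>
  define Q where "Q = S * u * a powr (- (1 + \<epsilon>))"
  define c where "c y = (if \<bar>y\<bar> \<le> a then y else 0)" for y :: real
  define m where "m j = expectation (\<lambda>x. c (X j x))" for j
  define Z where "Z j x = c (X j x) - m j" for j x
  have S: "0 < S" using J by (simp add: S_def card_gt_0_iff)
  then have a: "0 < a" using \<open>0 < r\<close> by (simp add: a_def)
  have meas: "X j \<in> borel_measurable M" if "j \<in> J" for j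
    using ind that by (auto simp: indep_vars_def)
  have [measurable]: "c \<in> borel_measurable borel" unfolding c_def by measurable
  have c_bound: "\<bar>c y\<bar> \<le> a" for y using a by (auto simp: c_def)
  have int_c: "integrable M (\<lambda>x. c (X j x))" if "j \<in> J" for j
    using c_bound meas[OF that] by (intro integrable_const_bound[where B = a]) auto
  note mb = moment_bound[OF meas \<open>0 \<le> u\<close> mom]
  have int_X: "integrable M (X j)" if "j \<in> J" for j
    using integrable_of_moment[OF meas e(1) mb(1)] that by blast
  have tail: "prob {x \<in> space M. a < \<bar>X j x\<bar>} \<le> u * a powr (- (1 + \<epsilon>))" if j: "j \<in> J" for j
  proof -
    have [measurable]: "X j \<in> borel_measurable M" by (rule meas[OF j])
    have "prob {x \<in> space M. a < \<bar>X j x\<bar>} = expectation (indicator {x \<in> space M. a < \<bar>X j x\<bar>})"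
      by simp
    also have "\<dots> \<le> expectation (\<lambda>x. \<bar>X j x\<bar> powr (1 + \<epsilon>) * a powr (- (1 + \<epsilon>)))"
    proof (rule integral_mono')
      fix x
      show "indicator {x \<in> space M. a < \<bar>X j x\<bar>} x \<le> \<bar>X j x\<bar> powr (1 + \<epsilon>) * a powr (- (1 + \<epsilon>))"
        using powr_tail[of a "X j x" "1 + \<epsilon>" 0] a e by (auto simp: indicator_def split: if_splits)
    qed (use mb j in auto)
    also have "\<dots> \<le> u * a powr (- (1 + \<epsilon>))"
      using mb[OF j j] by (simp add: mult_right_mono)
    finally show ?thesis .
  qed
  have bias: "\<bar>m j - \<mu>\<bar> \<le> u * a powr (- \<epsilon>)" if j: "j \<in> J" for j
  proof -
    have "\<mu> - m j = expectation (\<lambda>x. X j x - c (X j x))"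
      using int_X[OF j] int_c[OF j] mean[OF j] by (simp add: m_def)
    then have "\<bar>m j - \<mu>\<bar> = \<bar>expectation (\<lambda>x. X j x - c (X j x))\<bar>" by simp
    also have "\<dots> \<le> expectation (\<lambda>x. \<bar>X j x - c (X j x)\<bar>)" by (rule integral_abs_bound)
    also have "\<dots> \<le> expectation (\<lambda>x. \<bar>X j x\<bar> powr (1 + \<epsilon>) * a powr (- \<epsilon>))"
    proof (rule integral_mono')
      fix x
      show "\<bar>X j x - c (X j x)\<bar> \<le> \<bar>X j x\<bar> powr (1 + \<epsilon>) * a powr (- \<epsilon>)"
        using powr_tail[of a "X j x" \<epsilon> 1] a e by (auto simp: c_def)
    qed (use mb j in auto)
    also have "\<dots> \<le> u * a powr (- \<epsilon>)"
      using mb[OF j j] by (simp add: mult_right_mono)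
    finally show ?thesis .
  qed
  have int_c2: "integrable M (\<lambda>x. (c (X j x))\<^sup>2)" if "j \<in> J" for j
    using c_bound[THEN power_mono[where n = 2]] meas[OF that]
    by (intro integrable_const_bound[where B = "a\<^sup>2"]) auto
  have second: "expectation (\<lambda>x. (Z j x)\<^sup>2) \<le> u * a powr (1 - \<epsilon>)" if j: "j \<in> J" for j
  proof -
    have "expectation (\<lambda>x. (Z j x)\<^sup>2) = expectation (\<lambda>x. (c (X j x))\<^sup>2) - (m j)\<^sup>2"
      unfolding Z_def m_def using int_c[OF j] int_c2[OF j] by (rule variance_eq)
    also have "\<dots> \<le> expectation (\<lambda>x. (c (X j x))\<^sup>2)" by simp
    also have "\<dots> \<le> expectation (\<lambda>x. \<bar>X j x\<bar> powr (1 + \<epsilon>) * a powr (1 - \<epsilon>))"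
    proof (rule integral_mono')
      fix x
      \<comment> \<open>The truncation level pays for the part of the second moment that exceeds the
        available order \<open>1 + \<epsilon>\<close>; the exponent \<open>1 - \<epsilon>\<close>
        must be nonnegative here.\<close>
      have "\<bar>y\<bar> powr 2 \<le> \<bar>y\<bar> powr (1 + \<epsilon>) * a powr (1 - \<epsilon>)" if "\<bar>y\<bar> \<le> a" for y :: real
      proof -
        have "\<bar>y\<bar> powr 2 = \<bar>y\<bar> powr (1 + \<epsilon>) * \<bar>y\<bar> powr (1 - \<epsilon>)"
          by (simp add: powr_add[symmetric])
        also have "\<dots> \<le> \<bar>y\<bar> powr (1 + \<epsilon>) * a powr (1 - \<epsilon>)"
          using that e by (intro mult_left_mono powr_mono2) auto
        finally show ?thesis .
      qed
      then show "(c (X j x))\<^sup>2 \<le> \<bar>X j x\<bar> powr (1 + \<epsilon>) * a powr (1 - \<epsilon>)"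
        by (auto simp: c_def)
    qed (use mb j in auto)
    also have "\<dots> \<le> u * a powr (1 - \<epsilon>)"
      using mb[OF j j] by (simp add: mult_right_mono)
    finally show ?thesis .
  qed
  have ind_Z: "indep_vars (\<lambda>_. borel) Z J"
    unfolding Z_def by (rule indep_vars_compose2[OF ind]) measurable
  have sq_Z: "integrable M (\<lambda>x. (Z j x)\<^sup>2)" if "j \<in> J" for j
    using int_c[OF that] int_c2[OF that] unfolding Z_def power2_diff by simp
  have "expectation (Z j) = 0" if "j \<in> J" for j
    using int_c[OF that] unfolding Z_def by (simp add: m_def prob_space)
  note sumZ = expectation_sum_indep_square[OF J(1) ind_Z sq_Z this]
  have meas_Z: "Z j \<in> borel_measurable M" if "j \<in> J" for j
    using ind_Z that by (auto simp: indep_vars_def)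
  have cheb: "prob {x \<in> space M. a / 2 \<le> \<bar>\<Sum>j\<in>J. Z j x\<bar>} \<le> 4 * Q"
  proof -
    have "prob {x \<in> space M. a / 2 \<le> \<bar>\<Sum>j\<in>J. Z j x\<bar>} \<le> expectation (\<lambda>x. (\<Sum>j\<in>J. Z j x)\<^sup>2) / (a / 2)\<^sup>2"
      using sumZ(1) meas_Z a by (intro second_moment_method) auto
    also have "\<dots> \<le> (\<Sum>j\<in>J. u * a powr (1 - \<epsilon>)) / (a / 2)\<^sup>2"
      by (intro divide_right_mono order_trans[OF eq_refl[OF sumZ(2)]] sum_mono second) auto
    also have "\<dots> = 4 * (S * u * (a powr (1 - \<epsilon>) / a powr 2))"
      using a by (simp add: S_def power_divide)
    also have "a powr (1 - \<epsilon>) / a powr 2 = a powr (- (1 + \<epsilon>))"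
      by (simp add: powr_diff[symmetric])
    finally show ?thesis by (simp add: Q_def)
  qed
  \<comment> \<open>If no sample is truncated, the deviation of the sum exceeds
    \<open>a = S * r\<close> while the bias explains at most \<open>a / 2\<close>, so the centred
    truncated sum must account for the rest.\<close>
  have sub: "{x \<in> space M. r < \<bar>(\<Sum>j\<in>J. X j x) / S - \<mu>\<bar>} \<subseteq>
      (\<Union>j\<in>J. {x \<in> space M. a < \<bar>X j x\<bar>}) \<union> {x \<in> space M. a / 2 \<le> \<bar>\<Sum>j\<in>J. Z j x\<bar>}"
  proof
    fix x assume x: "x \<in> {x \<in> space M. r < \<bar>(\<Sum>j\<in>J. X j x) / S - \<mu>\<bar>}"
    show "x \<in> (\<Union>j\<in>J. {x \<in> space M. a < \<bar>X j x\<bar>}) \<union> {x \<in> space M. a / 2 \<le> \<bar>\<Sum>j\<in>J. Z j x\<bar>}"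
    proof (cases "\<exists>j\<in>J. a < \<bar>X j x\<bar>")
      case True
      then show ?thesis using x by auto
    next
      case False
      then have "c (X j x) = X j x" if "j \<in> J" for j using that by (auto simp: c_def)
      then have "(\<Sum>j\<in>J. X j x) - S * \<mu> = (\<Sum>j\<in>J. Z j x) + (\<Sum>j\<in>J. m j - \<mu>)"
        by (simp add: Z_def sum_subtractf S_def)
      moreover have "\<bar>\<Sum>j\<in>J. m j - \<mu>\<bar> \<le> a / 2"
      proof -
        have "\<bar>\<Sum>j\<in>J. m j - \<mu>\<bar> \<le> (\<Sum>j\<in>J. u * a powr (- \<epsilon>))"
          using bias by (intro order_trans[OF sum_abs] sum_mono)
        also have "\<dots> = a * Q"
        proof -
          have "a powr (- \<epsilon>) = a powr 1 * a powr (- (1 + \<epsilon>))"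
            by (simp only: powr_add[symmetric]) simp
          then show ?thesis using a by (simp add: Q_def S_def)
        qed
        also have "\<dots> \<le> a * (1 / 2)"
          using q a by (intro mult_left_mono) (auto simp: Q_def S_def a_def)
        finally show ?thesis by simp
      qed
      moreover have "a < \<bar>(\<Sum>j\<in>J. X j x) - S * \<mu>\<bar>"
      proof -
        have "(\<Sum>j\<in>J. X j x) - S * \<mu> = S * ((\<Sum>j\<in>J. X j x) / S - \<mu>)"
          using S by (simp add: algebra_simps)
        then have "\<bar>(\<Sum>j\<in>J. X j x) - S * \<mu>\<bar> = S * \<bar>(\<Sum>j\<in>J. X j x) / S - \<mu>\<bar>"
          using S by (simp add: abs_mult)
        then show ?thesis using x S by (simp add: a_def)
      qed
      ultimately have "a / 2 \<le> \<bar>\<Sum>j\<in>J. Z j x\<bar>" by linarith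
      then show ?thesis using x by auto
    qed
  qed
  have ev: "{x \<in> space M. a < \<bar>X j x\<bar>} \<in> events" if "j \<in> J" for j
    using meas[OF that] by measurable
  have evZ: "{x \<in> space M. a / 2 \<le> \<bar>\<Sum>j\<in>J. Z j x\<bar>} \<in> events"
    using meas_Z by measurable
  have "prob {x \<in> space M. r < \<bar>(\<Sum>j\<in>J. X j x) / S - \<mu>\<bar>} \<le>
      prob (\<Union>j\<in>J. {x \<in> space M. a < \<bar>X j x\<bar>}) + prob {x \<in> space M. a / 2 \<le> \<bar>\<Sum>j\<in>J. Z j x\<bar>}"
    using ev evZ J(1)
    by (intro order_trans[OF finite_measure_mono[OF sub]] measure_Un_le sets.Un sets.finite_UN)
  also have "prob (\<Union>j\<in>J. {x \<in> space M. a < \<bar>X j x\<bar>}) \<le> (\<Sum>j\<in>J. prob {x \<in> space M. a < \<bar>X j x\<bar>})"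
    using ev J by (intro measure_UNION_le) auto
  also have "\<dots> \<le> (\<Sum>j\<in>J. u * a powr (- (1 + \<epsilon>)))" by (intro sum_mono tail)
  also have "\<dots> = Q" by (simp add: Q_def S_def)
  finally show ?thesis using cheb by (simp add: Q_def S_def a_def)
qed

text \<open>A point lies in at least \<open>m\<close> of the events iff it lies in all events of
  some index set of size \<open>m\<close>. There are at most \<open>2 ^ n\<close> such sets, and
  independence gives each intersection probability at most \<open>p ^ m\<close>. Positivity of
  \<open>m\<close> keeps the intersections nonempty families.\<close>

lemma (in prob_space) prob_many_indep_events:
  fixes n m :: nat
  assumes ind: "indep_events A {..<n}" and p: "\<And>b. b < n \<Longrightarrow> prob (A b) \<le> p" and "0 \<le> p" and "0 < m"
  shows "{x \<in> space M. m \<le> card {b. b < n \<and> x \<in> A b}} \<in> events"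
    and "prob {x \<in> space M. m \<le> card {b. b < n \<and> x \<in> A b}} \<le> 2 ^ n * p ^ m"
proof -
  define F where "F = {S. S \<subseteq> {..<n} \<and> card S = m}"
  have ev: "A b \<in> events" if "b < n" for b using ind that by (auto simp: indep_events_def)
  have F: "finite F" "card F \<le> 2 ^ n"
  proof -
    have "F \<subseteq> Pow {..<n}" by (auto simp: F_def)
    then show "finite F" "card F \<le> 2 ^ n"
      using card_mono[of "Pow {..<n}" F] by (auto simp: card_Pow intro: finite_subset)
  qed
  have SF: "S \<noteq> {}" "finite S" "S \<subseteq> {..<n}" "card S = m" if "S \<in> F" for S
    using that \<open>0 < m\<close> by (auto simp: F_def intro: finite_subset)
  have evS: "(\<Inter>b\<in>S. A b) \<in> events" if "S \<in> F" for S
    using SF[OF that] ev by (intro sets.finite_INT) auto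
  have eq: "{x \<in> space M. m \<le> card {b. b < n \<and> x \<in> A b}} = (\<Union>S\<in>F. \<Inter>b\<in>S. A b)"
  proof (intro equalityI subsetI)
    fix x assume x: "x \<in> {x \<in> space M. m \<le> card {b. b < n \<and> x \<in> A b}}"
    then obtain S where "S \<subseteq> {b. b < n \<and> x \<in> A b}" "card S = m"
      using obtain_subset_with_card_n by blast
    then have "S \<in> F" "x \<in> (\<Inter>b\<in>S. A b)" by (auto simp: F_def)
    then show "x \<in> (\<Union>S\<in>F. \<Inter>b\<in>S. A b)" by blast
  next
    fix x assume "x \<in> (\<Union>S\<in>F. \<Inter>b\<in>S. A b)"
    then obtain S where S: "S \<in> F" "x \<in> (\<Inter>b\<in>S. A b)" by blast
    then have "S \<subseteq> {b. b < n \<and> x \<in> A b}" using SF(3) by auto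
    then have "m \<le> card {b. b < n \<and> x \<in> A b}"
      using SF(4)[OF S(1)] card_mono[of "{b. b < n \<and> x \<in> A b}" S] by simp
    moreover have "x \<in> space M" using evS[OF S(1)] S(2) sets.sets_into_space by blast
    ultimately show "x \<in> {x \<in> space M. m \<le> card {b. b < n \<and> x \<in> A b}}" by blast
  qed
  show "{x \<in> space M. m \<le> card {b. b < n \<and> x \<in> A b}} \<in> events"
    unfolding eq using F evS by auto
  have "prob (\<Union>S\<in>F. \<Inter>b\<in>S. A b) \<le> (\<Sum>S\<in>F. prob (\<Inter>b\<in>S. A b))"
    using F evS by (intro measure_UNION_le) auto
  also have "\<dots> \<le> (\<Sum>S\<in>F. p ^ m)"
  proof (rule sum_mono)
    fix S assume S: "S \<in> F"
    have "prob (\<Inter>b\<in>S. A b) = (\<Prod>b\<in>S. prob (A b))"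
      using ind SF[OF S] unfolding indep_events_def by blast
    also have "\<dots> \<le> (\<Prod>b\<in>S. p)" using SF[OF S] p by (intro prod_mono) auto
    finally show "prob (\<Inter>b\<in>S. A b) \<le> p ^ m" using SF[OF S] by simp
  qed
  also have "\<dots> = real (card F) * p ^ m" by simp
  also have "\<dots> \<le> 2 ^ n * p ^ m"
  proof (rule mult_right_mono)
    show "real (card F) \<le> 2 ^ n" using of_nat_mono[OF F(2), where 'a = real] by simp
  qed (use \<open>0 \<le> p\<close> in simp)
  finally show "prob {x \<in> space M. m \<le> card {b. b < n \<and> x \<in> A b}} \<le> 2 ^ n * p ^ m"
    unfolding eq .
qed

section \<open>Median of means and round-robin exploration\<close>

text \<open>With \<open>m\<close> the rank of the median, a median that is too large makes the last
  \<open>B - m + 1\<close> sorted block means too large, one that is too small makes the first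
  \<open>m\<close> too small. Both counts reach \<open>m\<close> because
  \<open>2 * m \<le> B + 1\<close>.\<close>

lemma median_of_means_deviation:
  assumes "r < \<bar>median_of_means B xs - \<mu>\<bar>" and "0 < B"
  shows "nat \<lceil>real B / 2\<rceil> \<le> card {b. b < B \<and> r < \<bar>block_mean B xs b - \<mu>\<bar>}"
proof -
  define ys where "ys = map (block_mean B xs) [0..<B]"
  define zs where "zs = sort ys"
  define m where "m = nat \<lceil>real B / 2\<rceil>"
  define P where "P y \<longleftrightarrow> r < \<bar>y - \<mu>\<bar>" for y
  have m: "0 < m" "m \<le> B" "2 * m \<le> B + 1" using \<open>0 < B\<close> unfolding m_def by linarith+
  have len: "length zs = B" by (simp add: zs_def ys_def)
  have mono: "zs ! i \<le> zs ! j" if "i \<le> j" "j < B" for i j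
    using that len by (intro sorted_nth_mono) (auto simp: zs_def)
  have "P (zs ! (m - 1))"
    using assms(1) by (simp add: P_def median_of_means_def zs_def ys_def m_def)
  then consider "\<mu> + r < zs ! (m - 1)" | "zs ! (m - 1) < \<mu> - r"
    unfolding P_def by linarith
  then have "m \<le> card {j. j < B \<and> P (zs ! j)}"
  proof cases
    case 1
    have "{m - 1..<B} \<subseteq> {j. j < B \<and> P (zs ! j)}"
    proof
      fix j assume "j \<in> {m - 1..<B}"
      then show "j \<in> {j. j < B \<and> P (zs ! j)}" using 1 mono[of "m - 1" j] by (auto simp: P_def)
    qed
    then have "card {m - 1..<B} \<le> card {j. j < B \<and> P (zs ! j)}" by (intro card_mono) auto
    then show ?thesis using m by simp
  next
    case 2
    have "{..<m} \<subseteq> {j. j < B \<and> P (zs ! j)}"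
    proof
      fix j assume "j \<in> {..<m}"
      then show "j \<in> {j. j < B \<and> P (zs ! j)}"
        using 2 mono[of j "m - 1"] m(1,2) by (fastforce simp: P_def)
    qed
    then have "card {..<m} \<le> card {j. j < B \<and> P (zs ! j)}" by (intro card_mono) auto
    then show ?thesis by simp
  qed
  \<comment> \<open>Sorting preserves the multiset, so the count over sorted positions becomes a
    count over block indices.\<close>
  also have "\<dots> = length (filter P zs)" by (simp add: length_filter_conv_card len)
  also have "\<dots> = size (filter_mset P (mset zs))" by (simp flip: mset_filter)
  also have "mset zs = mset ys" by (simp add: zs_def)
  also have "size (filter_mset P (mset ys)) = length (filter P ys)" by (simp flip: mset_filter)
  also have "\<dots> = card {b. b < B \<and> r < \<bar>block_mean B xs b - \<mu>\<bar>}"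
    unfolding length_filter_conv_card by (intro arg_cong[where f = card]) (auto simp: ys_def P_def)
  finally show ?thesis by (simp add: m_def)
qed

section \<open>Histories and round-robin counts\<close>

lemma length_play [simp]: "length (play \<pi> w x t) = t"
  by (induction t) (auto simp: Let_def)

lemma take_play: "t \<le> t' \<Longrightarrow> take t (play \<pi> w x t') = play \<pi> w x t"
  by (induction t') (auto simp: Let_def le_Suc_eq)

text \<open>Since the table is indexed by arm and number of earlier pulls, the observed rewards of
  an arm form an initial segment of its row under any policy; only the length of the segment depends
  on the policy.\<close>

lemma samples_play:
  "samples i (play \<pi> w x t) = map (\<lambda>s. x (i, s)) [0..<length (samples i (play \<pi> w x t))]"
  by (induction t) (auto simp: Let_def samples_def)

lemma length_samples_round_robin:
  assumes "\<And>h. length h < L \<Longrightarrow> \<pi> w h = 1 + length h mod K" and "t \<le> L"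
  shows "length (samples i (play \<pi> w x t)) = card {s. s < t \<and> 1 + s mod K = i}"
  using \<open>t \<le> L\<close>
proof (induction t)
  case (Suc t)
  have "{s. s < Suc t \<and> 1 + s mod K = i} =
      (if 1 + t mod K = i then insert t {s. s < t \<and> 1 + s mod K = i}
       else {s. s < t \<and> 1 + s mod K = i})"
    by (auto simp: less_Suc_eq)
  then show ?case using Suc assms(1)[of "play \<pi> w x t"] by (simp add: Let_def samples_def)
qed (simp add: samples_def)

text \<open>Every complete cycle of length \<open>K\<close> visits arm \<open>i\<close> once, which
  gives the lower bound; the upper bound holds because the cycle number \<open>s div K\<close> is
  injective on the visits.\<close>

lemma card_residue_class:
  fixes K t i :: nat
  assumes "i \<in> {1..K}"
  shows "t div K \<le> card {s. s < t \<and> 1 + s mod K = i}"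
    and "card {s. s < t \<and> 1 + s mod K = i} \<le> t div K + 1"
proof -
  have K: "0 < K" using assms by auto
  have "(\<lambda>q. q * K + (i - 1)) ` {..<t div K} \<subseteq> {s. s < t \<and> 1 + s mod K = i}"
  proof safe
    fix q assume "q < t div K"
    then have "(q + 1) * K \<le> t div K * K" by (intro mult_right_mono) auto
    also have "\<dots> \<le> t" by simp
    finally show "q * K + (i - 1) < t" using assms by (simp add: algebra_simps) linarith
    have "(q * K + (i - 1)) mod K = (i - 1) mod K" by simp
    moreover have "(i - 1) mod K = i - 1" using assms by (intro mod_less) auto
    ultimately show "1 + (q * K + (i - 1)) mod K = i" using assms by (simp del: Nat.add_diff_assoc Nat.add_diff_assoc2 Nat.diff_diff_right)
  qed
  then have "card ((\<lambda>q. q * K + (i - 1)) ` {..<t div K}) \<le> card {s. s < t \<and> 1 + s mod K = i}"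
    by (intro card_mono) auto
  moreover have "inj_on (\<lambda>q. q * K + (i - 1)) {..<t div K}" using K by (auto simp: inj_on_def)
  ultimately show "t div K \<le> card {s. s < t \<and> 1 + s mod K = i}" by (simp add: card_image)
  have "inj_on (\<lambda>s. s div K) {s. s < t \<and> 1 + s mod K = i}"
    by (rule inj_onI) (metis (mono_tags, lifting) add_left_cancel div_mult_mod_eq mem_Collect_eq)
  moreover have "(\<lambda>s. s div K) ` {s. s < t \<and> 1 + s mod K = i} \<subseteq> {..t div K}"
    by (auto intro!: div_le_mono)
  ultimately show "card {s. s < t \<and> 1 + s mod K = i} \<le> t div K + 1"
    using card_inj_on_le[of _ _ "{..t div K}"] by fastforce
qed

section \<open>Gaps and the cost of exploration\<close>

lemma gap_nonneg: "i \<in> {1..K} \<Longrightarrow> 0 \<le> gap K \<nu> i"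
  by (simp add: gap_def best_mean_def)

lemma best_mean_attained:
  assumes "0 < K"
  obtains j where "j \<in> {1..K}" "best_mean K \<nu> = arm_mean \<nu> j"
proof -
  have "best_mean K \<nu> \<in> arm_mean \<nu> ` {1..K}"
    unfolding best_mean_def using assms by (intro Max_in) auto
  then show ?thesis using that by auto
qed

text \<open>For an optimal arm \<open>j\<close>, the estimates lose \<open>r\<close> twice: the mean
  of \<open>j\<close> is at most \<open>f j + r\<close>, and \<open>f j \<le> f i\<close> is at most
  the mean of \<open>i\<close> plus \<open>r\<close>.\<close>

lemma gap_le_of_estimates:
  assumes "i \<in> {1..K}" and "\<And>j. j \<in> {1..K} \<Longrightarrow> \<bar>f j - arm_mean \<nu> j\<bar> \<le> r"
    and "\<And>j. j \<in> {1..K} \<Longrightarrow> f j \<le> f i"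
  shows "gap K \<nu> i \<le> 2 * r"
proof -
  have "0 < K" using assms(1) by auto
  then obtain j where j: "j \<in> {1..K}" "best_mean K \<nu> = arm_mean \<nu> j"
    by (rule best_mean_attained)
  then show ?thesis
    using assms(2)[OF j(1)] assms(2)[OF assms(1)] assms(3)[OF j(1)] by (simp add: gap_def)
qed

text \<open>Grouping by arm replaces the length \<open>L\<close> by about \<open>L / K\<close> pulls
  of each arm, the +1 covering an incomplete cycle. This gives the sharp constant in the asymptotic
  claim.\<close>

lemma sum_round_robin_le:
  fixes g :: "nat \<Rightarrow> real"
  assumes "0 < K" and "\<And>i. i \<in> {1..K} \<Longrightarrow> 0 \<le> g i"
  shows "(\<Sum>s<L. g (1 + s mod K)) \<le> real (L div K + 1) * (\<Sum>i\<in>{1..K}. g i)"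
proof -
  have "(\<Sum>s<L. g (1 + s mod K)) = (\<Sum>i\<in>{1..K}. \<Sum>s\<in>{s. s \<in> {..<L} \<and> 1 + s mod K = i}. g (1 + s mod K))"
    using \<open>0 < K\<close> by (subst sum.group) (auto simp: Suc_le_eq)
  also have "\<dots> = (\<Sum>i\<in>{1..K}. real (card {s. s < L \<and> 1 + s mod K = i}) * g i)"
    by (intro sum.cong) (auto intro: sum.cong simp flip: of_nat_Suc)
  also have "\<dots> \<le> (\<Sum>i\<in>{1..K}. real (L div K + 1) * g i)"
    using card_residue_class(2) assms(2)
    by (intro sum_mono mult_right_mono) (auto simp del: of_nat_Suc of_nat_add)
  finally show ?thesis by (simp add: sum_distrib_left)
qed

section \<open>Behaviour of the policy in its two phases\<close>

lemma adar_etc_arm_explore: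
  assumes "adar_etc K T \<pi>" and "s < explore_length K T"
  shows "arm_at \<pi> w x (Suc s) = 1 + s mod K"
  using assms by (simp add: adar_etc_def arm_at_def)

text \<open>Exploration ignores the rewards, so the sample counts are deterministic and the
  estimates use fixed cells of the table. This is what makes independence applicable.\<close>

lemma adar_etc_samples:
  assumes "adar_etc K T \<pi>"
  defines "L \<equiv> explore_length K T"
  shows "samples i (play \<pi> w x L) = map (\<lambda>s. x (i, s)) [0..<card {s. s < L \<and> 1 + s mod K = i}]"
proof -
  have "length (samples i (play \<pi> w x L)) = card {s. s < L \<and> 1 + s mod K = i}"
    using assms by (intro length_samples_round_robin[where L = L]) (auto simp: adar_etc_def)
  then show ?thesis using samples_play[of i \<pi> w x L] by simp
qed

text \<open>The first \<open>explore_length K T\<close> entries of every later history are the same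
  exploration history \<open>e\<close>, so each committed round maximizes the same
  estimates.\<close>

lemma adar_etc_arm_commit:
  fixes w x
  assumes "adar_etc K T \<pi>" and "explore_length K T \<le> s" "s < T"
  defines "e \<equiv> play \<pi> w x (explore_length K T)"
  shows "arm_at \<pi> w x (Suc s) \<in> {1..K}"
    and "j \<in> {1..K} \<Longrightarrow> median_of_means (num_blocks K T) (samples j e)
      \<le> median_of_means (num_blocks K T) (samples (arm_at \<pi> w x (Suc s)) e)"
proof -
  have "take (explore_length K T) (play \<pi> w x s) = e"
    using take_play[OF assms(2)] by (simp add: e_def)
  moreover have "explore_length K T \<le> length (play \<pi> w x s)" "length (play \<pi> w x s) < T"
    using assms by simp_all
  ultimately have "\<pi> w (play \<pi> w x s) \<in> {1..K} \<and> (\<forall>j\<in>{1..K}.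
      median_of_means (num_blocks K T) (samples j e)
        \<le> median_of_means (num_blocks K T) (samples (\<pi> w (play \<pi> w x s)) e))"
    using assms(1) unfolding adar_etc_def Let_def by metis
  then show "arm_at \<pi> w x (Suc s) \<in> {1..K}"
    and "j \<in> {1..K} \<Longrightarrow> median_of_means (num_blocks K T) (samples j e)
      \<le> median_of_means (num_blocks K T) (samples (arm_at \<pi> w x (Suc s)) e)"
    by (simp_all add: arm_at_def)
qed

text \<open>Block \<open>b\<close> ends at or before \<open>B * (n div B) \<le> n\<close>, so
  \<open>!\<close> stays inside the list.\<close>

lemma block_mean_map:
  assumes "b < B"
  shows "block_mean B (map f [0..<n]) b =
    (\<Sum>l = b * (n div B)..<(b + 1) * (n div B). f l) / real (n div B)"
proof -
  have "l < n" if "l < (b + 1) * (n div B)" for l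
  proof -
    have "(b + 1) * (n div B) \<le> B * (n div B)" using assms by (intro mult_right_mono) auto
    also have "\<dots> \<le> n" by simp
    finally show ?thesis using that by linarith
  qed
  then show ?thesis unfolding block_mean_def Let_def length_map length_upt diff_zero
    by (intro arg_cong2[where f = "(/)"] sum.cong) auto
qed

section \<open>Concentration of the exploration rewards\<close>

text \<open>The PiM lemmas of the library need a probability measure at every index.\<close>

definition reward_measure :: "nat \<Rightarrow> (nat \<Rightarrow> real measure) \<Rightarrow> nat \<times> nat \<Rightarrow> real measure" where
  "reward_measure K \<nu> p = (if fst p \<in> {1..K} then \<nu> (fst p) else return borel 0)"

text \<open>The second factor of \<open>bandit_space\<close>. Exploration estimates depend on this
  factor alone, so concentration can be proved without the seed.\<close>

definition reward_table :: "nat \<Rightarrow> (nat \<Rightarrow> real measure) \<Rightarrow> (nat \<times> nat \<Rightarrow> real) measure" where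
  "reward_table K \<nu> = PiM ({1..K} \<times> UNIV) (reward_measure K \<nu>)"

context
  fixes K :: nat and \<nu> :: "nat \<Rightarrow> real measure" and \<epsilon> u :: real
  assumes ht: "\<nu> \<in> heavy_tailed \<epsilon> u K"
begin

lemma prob_space_reward_measure: "prob_space (reward_measure K \<nu> p)"
  using ht by (auto simp: reward_measure_def heavy_tailed_def intro!: prob_space_return)

lemma sets_reward_measure: "sets (reward_measure K \<nu> p) = sets borel"
  using ht by (auto simp: reward_measure_def heavy_tailed_def)

lemma prob_space_reward_table: "prob_space (reward_table K \<nu>)"
  unfolding reward_table_def by (intro prob_space_PiM prob_space_reward_measure)

lemma bandit_space_eq: "bandit_space K \<nu> = uniform_measure lborel {0..1} \<Otimes>\<^sub>M reward_table K \<nu>"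
  unfolding bandit_space_def reward_table_def
  by (intro arg_cong2[where f = pair_measure] PiM_cong) (auto simp: reward_measure_def)

lemma measurable_reward [measurable]:
  "p \<in> {1..K} \<times> UNIV \<Longrightarrow> (\<lambda>x. x p) \<in> borel_measurable (reward_table K \<nu>)"
  unfolding reward_table_def
  using measurable_component_singleton[of p "{1..K} \<times> UNIV" "reward_measure K \<nu>"]
    measurable_cong_sets[OF refl sets_reward_measure] by blast

lemma distr_reward:
  assumes "i \<in> {1..K}"
  shows "distr (reward_table K \<nu>) borel (\<lambda>x. x (i, s)) = \<nu> i"
proof -
  have "distr (reward_table K \<nu>) borel (\<lambda>x. x (i, s)) =
      distr (reward_table K \<nu>) (reward_measure K \<nu> (i, s)) (\<lambda>x. x (i, s))"
    by (intro distr_cong) (auto simp: sets_reward_measure)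
  also have "\<dots> = reward_measure K \<nu> (i, s)"
    unfolding reward_table_def using assms
    by (intro distr_PiM_component prob_space_reward_measure) auto
  finally show ?thesis using assms by (simp add: reward_measure_def)
qed

text \<open>Independence is the identity between the joint law and the product of the marginals. The
  joint law of the coordinates is the table measure itself, and its marginals are its
  factors.\<close>

lemma indep_vars_reward:
  assumes "0 < K"
  shows "prob_space.indep_vars (reward_table K \<nu>) (\<lambda>_. borel) (\<lambda>p x. x p) ({1..K} \<times> UNIV)"
proof -
  interpret P: prob_space "reward_table K \<nu>" by (rule prob_space_reward_table)
  let ?I = "{1..K} \<times> (UNIV :: nat set)"
  have *: "P.indep_vars (reward_measure K \<nu>) (\<lambda>p x. x p) ?I"
  proof (subst P.indep_vars_iff_distr_eq_PiM')
    show "?I \<noteq> {}" using assms by auto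
    show "(\<lambda>x. x p) \<in> measurable (reward_table K \<nu>) (reward_measure K \<nu> p)" if "p \<in> ?I" for p
      unfolding reward_table_def using that by (rule measurable_component_singleton)
    have "distr (reward_table K \<nu>) (PiM ?I (reward_measure K \<nu>)) (\<lambda>x. \<lambda>p\<in>?I. x p) =
        distr (reward_table K \<nu>) (reward_table K \<nu>) (\<lambda>x. x)"
      by (intro distr_cong) (auto simp: reward_table_def space_PiM PiE_restrict)
    also have "\<dots> = PiM ?I (reward_measure K \<nu>)" by (simp add: distr_id2 reward_table_def)
    also have "\<dots> = PiM ?I (\<lambda>p. distr (reward_table K \<nu>) (reward_measure K \<nu> p) (\<lambda>x. x p))"
      unfolding reward_table_def
      by (intro PiM_cong distr_PiM_component[symmetric] prob_space_reward_measure) auto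
    finally show "distr (reward_table K \<nu>) (PiM ?I (reward_measure K \<nu>)) (\<lambda>x. \<lambda>p\<in>?I. x p) =
        PiM ?I (\<lambda>p. distr (reward_table K \<nu>) (reward_measure K \<nu> p) (\<lambda>x. x p))" .
  qed
  \<comment> \<open>Composing with the identity replaces each \<open>reward_measure\<close> as
    target space by \<open>borel\<close>, which has the same measurable sets.\<close>
  show ?thesis
    using P.indep_vars_compose2[OF *, of "\<lambda>_ y. y" "\<lambda>_. borel"]
    by (simp add: measurable_ident_sets sets_reward_measure)
qed

lemma reward_moment:
  assumes "i \<in> {1..K}"
  shows "(\<integral>\<^sup>+ x. ennreal (\<bar>x (i, s)\<bar> powr (1 + \<epsilon>)) \<partial>reward_table K \<nu>) \<le> ennreal u"
proof -
  have "(\<integral>\<^sup>+ x. ennreal (\<bar>x (i, s)\<bar> powr (1 + \<epsilon>)) \<partial>reward_table K \<nu>) =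
      (\<integral>\<^sup>+ y. ennreal (\<bar>y\<bar> powr (1 + \<epsilon>)) \<partial>distr (reward_table K \<nu>) borel (\<lambda>x. x (i, s)))"
    using assms by (subst nn_integral_distr) auto
  then show ?thesis using assms ht by (simp add: distr_reward heavy_tailed_def)
qed

lemma reward_mean:
  assumes "i \<in> {1..K}"
  shows "(\<integral>x. x (i, s) \<partial>reward_table K \<nu>) = arm_mean \<nu> i"
proof -
  have "(\<integral>x. x (i, s) \<partial>reward_table K \<nu>) =
      (\<integral>y. y \<partial>distr (reward_table K \<nu>) borel (\<lambda>x. x (i, s)))"
    using assms by (subst integral_distr) auto
  then show ?thesis using assms by (simp add: distr_reward arm_mean_def)
qed

text \<open>Two means of size at most \<open>2 * u powr (1 / (1 + \<epsilon>))\<close> differ by at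
  most twice that. This is the price of a round about which nothing better is known.\<close>

lemma gap_le:
  assumes "i \<in> {1..K}" and "0 < \<epsilon>" "0 < u"
  shows "gap K \<nu> i \<le> 4 * u powr (1 / (1 + \<epsilon>))"
proof -
  have "\<bar>arm_mean \<nu> j\<bar> \<le> 2 * u powr (1 / (1 + \<epsilon>))" if "j \<in> {1..K}" for j
  proof -
    interpret prob_space "\<nu> j" using ht that by (auto simp: heavy_tailed_def)
    have "sets (\<nu> j) = sets borel" using ht that by (auto simp: heavy_tailed_def)
    then have "(\<lambda>x. x) \<in> borel_measurable (\<nu> j)" by (rule measurable_ident_sets)
    then show ?thesis
      unfolding arm_mean_def using ht that assms
      by (intro abs_expectation_le_moment) (auto simp: heavy_tailed_def)
  qed
  note mean = this
  obtain j where "j \<in> {1..K}" "best_mean K \<nu> = arm_mean \<nu> j"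
    using assms(1) by (auto intro: best_mean_attained[of K \<nu>])
  then show ?thesis using mean[of j] mean[OF assms(1)] unfolding gap_def by linarith
qed

text \<open>The constant 40 is 5 * 8: hypothesis \<open>r\<close> makes the quantity in the
  deviation bound at most 1/40, and that bound multiplies it by 5.\<close>

lemma prob_block_deviation:
  fixes s b :: nat
  assumes "i \<in> {1..K}" and "0 < \<epsilon>" "\<epsilon> \<le> 1" "0 < u" "0 < r" "0 < s"
    and r: "40 * real s * u \<le> (real s * r) powr (1 + \<epsilon>)"
  shows "measure (reward_table K \<nu>) {x \<in> space (reward_table K \<nu>).
      r < \<bar>(\<Sum>l = b * s..<(b + 1) * s. x (i, l)) / real s - arm_mean \<nu> i\<bar>} \<le> 1 / 8"
proof -
  interpret P: prob_space "reward_table K \<nu>" by (rule prob_space_reward_table)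
  define J where "J = Pair i ` {b * s..<(b + 1) * s}"
  have J: "finite J" "J \<noteq> {}" "J \<subseteq> {1..K} \<times> UNIV" using assms by (auto simp: J_def)
  have card: "card J = s" by (simp add: J_def card_image inj_on_def)
  have ind: "P.indep_vars (\<lambda>_. borel) (\<lambda>p x. x p) J"
    using assms(1) J by (intro P.indep_vars_subset[OF indep_vars_reward]) auto
  have "real s * u * (real s * r) powr (- (1 + \<epsilon>)) \<le> 1 / 40"
    using r assms unfolding powr_minus by (simp add: field_simps)
  moreover have "(\<integral>\<^sup>+ x. ennreal (\<bar>x p\<bar> powr (1 + \<epsilon>)) \<partial>reward_table K \<nu>) \<le> ennreal u"
    "(\<integral>x. x p \<partial>reward_table K \<nu>) = arm_mean \<nu> i" if "p \<in> J" for p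
    using that assms(1) reward_moment reward_mean by (auto simp: J_def)
  ultimately have "P.prob {x \<in> space (reward_table K \<nu>).
      r < \<bar>(\<Sum>p\<in>J. x p) / real (card J) - arm_mean \<nu> i\<bar>} \<le> 5 * (1 / 40)"
    using assms(2-5) J(1,2) ind
    by (intro order_trans[OF P.heavy_tailed_mean_deviation[where u = u and \<epsilon> = \<epsilon>]])
      (auto simp: card)
  also have "(\<lambda>x. \<Sum>p\<in>J. x p) = (\<lambda>x. \<Sum>l = b * s..<(b + 1) * s. x (i, l) :: real)"
    by (simp add: J_def sum.reindex inj_on_def)
  finally show ?thesis by (simp add: card)
qed

text \<open>Distinct blocks read disjoint cells, so their deviations are independent events of
  probability at most 1/8, and the union bound over sets of bad blocks applies.\<close>

lemma prob_many_block_deviations: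
  fixes s B m :: nat
  assumes i: "i \<in> {1..K}" and "0 < \<epsilon>" "\<epsilon> \<le> 1" "0 < u" "0 < r" "0 < s"
    and r: "40 * real s * u \<le> (real s * r) powr (1 + \<epsilon>)" and m: "0 < m" "B \<le> 2 * m"
  defines "E \<equiv> {x \<in> space (reward_table K \<nu>). m \<le> card {b. b < B \<and>
      r < \<bar>(\<Sum>l = b * s..<(b + 1) * s. x (i, l)) / real s - arm_mean \<nu> i\<bar>}}"
  shows "E \<in> sets (reward_table K \<nu>)" and "measure (reward_table K \<nu>) E \<le> (1 / 2) ^ m"
proof -
  interpret P: prob_space "reward_table K \<nu>" by (rule prob_space_reward_table)
  define J where "J b = Pair i ` {b * s..<(b + 1) * s}" for b
  define A where "A b = {x \<in> space (reward_table K \<nu>).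
      r < \<bar>(\<Sum>l = b * s..<(b + 1) * s. x (i, l)) / real s - arm_mean \<nu> i\<bar>}" for b
  have disj: "disjoint_family_on J {..<B}"
    unfolding disjoint_family_on_def
  proof (intro ballI impI)
    fix b c :: nat assume "b \<noteq> c"
    have "(b + 1) * s \<le> c * s \<or> (c + 1) * s \<le> b * s"
      using \<open>b \<noteq> c\<close> mult_le_mono1[of "b + 1" c s] mult_le_mono1[of "c + 1" b s] by linarith
    then show "J b \<inter> J c = {}" by (auto simp: J_def)
  qed
  \<comment> \<open>Independence of cells is grouped into independence of the restrictions to
    disjoint blocks; each block sum is then a measurable function of its restriction.\<close>
  have "P.indep_vars (\<lambda>b. PiM (J b) (\<lambda>_. borel)) (\<lambda>b x. restrict (\<lambda>p. x p) (J b)) {..<B}"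
    using i by (intro P.indep_vars_restrict[OF indep_vars_reward] disj) (auto simp: J_def)
  then have "P.indep_vars (\<lambda>_. borel)
      (\<lambda>b x. \<Sum>l = b * s..<(b + 1) * s. restrict (\<lambda>p. x p) (J b) (i, l)) {..<B}"
    by (rule P.indep_vars_compose2)
      (auto intro!: borel_measurable_sum measurable_component_singleton simp: J_def)
  also have "(\<lambda>b x. \<Sum>l = b * s..<(b + 1) * s. restrict (\<lambda>p. x p) (J b) (i, l)) =
      (\<lambda>b x. \<Sum>l = b * s..<(b + 1) * s. x (i, l) :: real)"
    by (intro ext sum.cong) (auto simp: J_def)
  finally have "P.indep_events A {..<B}"
    unfolding A_def by (rule P.indep_eventsI_indep_vars) measurable
  note indep = this
  have E: "E = {x \<in> space (reward_table K \<nu>). m \<le> card {b. b < B \<and> x \<in> A b}}"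
    by (auto simp: E_def A_def intro!: arg_cong[where f = card])
  have A: "P.prob (A b) \<le> 1 / 8" for b
    unfolding A_def by (intro prob_block_deviation assms)
  have "(0 :: real) \<le> 1 / 8" by simp
  note many = P.prob_many_indep_events[OF indep A this m(1), folded E]
  show "E \<in> sets (reward_table K \<nu>)" by (rule many(1))
  have "P.prob E \<le> 2 ^ B * (1 / 8) ^ m" by (rule many(2))
  \<comment> \<open>Since \<open>m\<close> is at least half of \<open>B\<close>, the number of sets
    contributes at most a factor 4 per bad block, and 4/8 = 1/2 remains.\<close>
  also have "\<dots> \<le> 2 ^ (2 * m) * (1 / 8) ^ m"
    using m by (intro mult_right_mono power_increasing) auto
  also have "\<dots> = (1 / 2 :: real) ^ m" by (simp add: power_mult flip: power_mult_distrib)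
  finally show "P.prob E \<le> (1 / 2) ^ m" .
qed

end

section \<open>Regret bounds\<close>

lemma real_nat_ceiling_le: "0 \<le> x \<Longrightarrow> real (nat \<lceil>x\<rceil>) \<le> x + 1" for x :: real
  by linarith

lemma num_blocks_bounds:
  assumes "2 \<le> K" "1 \<le> T"
  shows "0 < num_blocks K T"
    and "8 * ln (real K * real T ^ 3) \<le> real (num_blocks K T)"
    and "real (num_blocks K T) \<le> 24 * (1 + ln (real K * real T))"
proof -
  have ln: "ln (real K * real T ^ 3) = ln (real K) + 3 * ln (real T)"
    using assms by (simp add: ln_mult ln_realpow)
  have pos: "0 < ln (real K)" "0 \<le> ln (real T)" using assms by auto
  then show "0 < num_blocks K T" unfolding num_blocks_def ln by simp
  show "8 * ln (real K * real T ^ 3) \<le> real (num_blocks K T)"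
    unfolding num_blocks_def by linarith
  have "ln (real K * real T) = ln (real K) + ln (real T)" using assms by (simp add: ln_mult)
  then show "real (num_blocks K T) \<le> 24 * (1 + ln (real K * real T))"
    using pos real_nat_ceiling_le[of "8 * ln (real K * real T ^ 3)"]
    unfolding num_blocks_def ln by argo
qed

text \<open>The 8 in \<open>num_blocks\<close> makes the exponent at least
  \<open>4 * ln (real K * real T ^ 3)\<close>, while \<open>ln (1 / 2) \<le> - 1 / 4\<close>. The
  factor \<open>K\<close> accounts for the union over the arms.\<close>

lemma half_power_num_blocks:
  assumes "2 \<le> K" "1 \<le> T"
  shows "real K * (1 / 2) ^ nat \<lceil>real (num_blocks K T) / 2\<rceil> \<le> 1 / real T ^ 3"
proof -
  define m where "m = nat \<lceil>real (num_blocks K T) / 2\<rceil>"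
  have pos: "0 < real K" "0 < real T" using assms by auto
  have "ln (1 / 2 :: real) \<le> 1 / 2 - 1" by (rule ln_le_minus_one) simp
  then have "real m * ln (1 / 2) \<le> real m * (- (1 / 4))"
    by (intro mult_left_mono) auto
  moreover have "ln (real K * real T ^ 3) \<le> real m / 4"
    using num_blocks_bounds(2)[OF assms] unfolding m_def by linarith
  ultimately have "real m * ln (1 / 2) \<le> - ln (real K * real T ^ 3)" by linarith
  then have "exp (real m * ln (1 / 2)) \<le> exp (- ln (real K * real T ^ 3))" by simp
  also have "exp (real m * ln (1 / 2)) = (1 / 2) ^ m" by (simp add: exp_of_nat_mult)
  also have "exp (- ln (real K * real T ^ 3)) = 1 / (real K * real T ^ 3)"
    using pos by (simp add: exp_minus inverse_eq_divide)
  finally have "real K * (1 / 2) ^ m \<le> real K * (1 / (real K * real T ^ 3))"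
    using pos by (intro mult_left_mono) auto
  then show ?thesis using pos by (simp add: m_def)
qed

lemma explore_length_le:
  "real (explore_length K T)
    \<le> real K * real (num_blocks K T) + real K powr (1/3) * real T powr (2/3) + 1"
proof -
  have "real (explore_length K T) \<le>
      real (K * num_blocks K T + nat \<lceil>real K powr (1/3) * real T powr (2/3)\<rceil>)"
    unfolding explore_length_def of_nat_le_iff by simp
  also have "\<dots> \<le> real K * real (num_blocks K T) + (real K powr (1/3) * real T powr (2/3) + 1)"
  proof -
    have "0 \<le> real K powr (1/3) * real T powr (2/3)" by simp
    then show ?thesis by simp
  qed
  finally show ?thesis by simp
qed

text \<open>The summand \<open>K * num_blocks K T\<close> of the exploration length guarantees one
  sample per block and offsets the rounding of the second division; the other summand provides the
  growth of the blocks.\<close>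

lemma block_size_lower_bounds:
  assumes "2 \<le> K" "1 \<le> T" and L: "explore_length K T < T"
  defines "s \<equiv> explore_length K T div K div num_blocks K T"
  shows "0 < s"
    and "real K powr (-2/3) * real T powr (2/3) / real (num_blocks K T) \<le> 2 * real s"
proof -
  define B where "B = num_blocks K T"
  define y where "y = real K powr (-2/3) * real T powr (2/3)"
  define n where "n = explore_length K T div K"
  have B: "0 < B" using num_blocks_bounds(1)[OF assms(1,2)] by (simp add: B_def)
  have K: "0 < real K" using assms by simp
  have eq: "explore_length K T = K * B + nat \<lceil>real K powr (1/3) * real T powr (2/3)\<rceil>"
    using L by (simp add: explore_length_def B_def)
  have "real K powr (1/3) = real K powr 1 * real K powr (-2/3)"
    unfolding powr_add[symmetric] by simp
  then have Ky: "real K powr (1/3) * real T powr (2/3) = real K * y" by (simp add: y_def)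
  have "B \<le> n" using K unfolding n_def eq by (simp add: div_add1_eq)
  then show s: "0 < s" using B unfolding s_def n_def[symmetric] B_def[symmetric]
    by (simp add: div_greater_zero_iff)
  have div_gt: "real a / real b - 1 \<le> real (a div b)" for a b :: nat
    using floor_divide_of_nat_eq[of a b, where 'a = real] by linarith
  have "real K * (real B + y) \<le> real (explore_length K T)"
    unfolding eq using Ky by (simp add: distrib_left) linarith
  then have "real B + y \<le> real (explore_length K T) / real K"
    using K by (simp add: field_simps)
  then have "real B + y - 1 \<le> real n" using div_gt[of "explore_length K T" K] by (simp add: n_def)
  then have "(real B + y - 1) / real B \<le> real n / real B" using B by (simp add: divide_right_mono)
  then have "1 + (y - 1) / real B \<le> real n / real B" using B by (simp add: field_simps)
  then have "(y - 1) / real B \<le> real s"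
    using div_gt[of n B] unfolding s_def n_def[symmetric] B_def[symmetric] by linarith
  \<comment> \<open>The remaining rounding loss \<open>1 / B\<close> is at most \<open>s\<close>,
    which is where the factor 2 comes from.\<close>
  moreover have "1 / real B \<le> 1" "1 \<le> real s" using B s by auto
  ultimately have "y / real B \<le> 2 * real s" unfolding diff_divide_distrib by linarith
  then show "real K powr (-2/3) * real T powr (2/3) / real (num_blocks K T) \<le> 2 * real s"
    by (simp add: y_def B_def)
qed

section \<open>Regret on and off the event of bad estimates\<close>

context
  fixes K T :: nat and \<nu> :: "nat \<Rightarrow> real measure" and \<epsilon> u :: real and \<pi> :: policy
  assumes ht: "\<nu> \<in> heavy_tailed \<epsilon> u K" and K: "2 \<le> K" and T: "1 \<le> T"
    and eps: "0 < \<epsilon>" "\<epsilon> \<le> 1" and u: "0 < u" and adar: "adar_etc K T \<pi>"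
begin

lemma prob_space_bandit: "prob_space (bandit_space K \<nu>)"
proof -
  interpret R: prob_space "reward_table K \<nu>" by (rule prob_space_reward_table[OF ht])
  interpret U: prob_space "uniform_measure lborel {0..1::real}"
    by (intro prob_space_uniform_measure) auto
  interpret pair_prob_space "uniform_measure lborel {0..1::real}" "reward_table K \<nu>" ..
  show ?thesis unfolding bandit_space_eq[OF ht] by (rule prob_space_axioms)
qed

lemma measure_bandit_snd:
  assumes "E \<in> sets (reward_table K \<nu>)"
  shows "{\<omega> \<in> space (bandit_space K \<nu>). snd \<omega> \<in> E} \<in> sets (bandit_space K \<nu>)"
    and "measure (bandit_space K \<nu>) {\<omega> \<in> space (bandit_space K \<nu>). snd \<omega> \<in> E}
      = measure (reward_table K \<nu>) E"
proof -
  interpret R: prob_space "reward_table K \<nu>" by (rule prob_space_reward_table[OF ht])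
  interpret U: prob_space "uniform_measure lborel {0..1::real}"
    by (intro prob_space_uniform_measure) auto
  interpret pair_prob_space "uniform_measure lborel {0..1::real}" "reward_table K \<nu>" ..
  have eq: "{\<omega> \<in> space (bandit_space K \<nu>). snd \<omega> \<in> E} = space (uniform_measure lborel {0..1}) \<times> E"
    using sets.sets_into_space[OF assms] unfolding bandit_space_eq[OF ht]
    by (auto simp: space_pair_measure)
  show "{\<omega> \<in> space (bandit_space K \<nu>). snd \<omega> \<in> E} \<in> sets (bandit_space K \<nu>)"
    unfolding eq unfolding bandit_space_eq[OF ht] using assms by (intro pair_measureI) auto
  show "measure (bandit_space K \<nu>) {\<omega> \<in> space (bandit_space K \<nu>). snd \<omega> \<in> E}
      = measure (reward_table K \<nu>) E"
    unfolding eq unfolding bandit_space_eq[OF ht] using assms U.prob_space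
    by (subst measure_def, subst R.emeasure_pair_measure_Times)
      (simp_all add: measure_def U.emeasure_space_1
        del: space_uniform_measure sets_uniform_measure)
qed

lemma regret_eq:
  "regret K T \<nu> \<pi> = (\<integral>\<omega>. (\<Sum>s<T. gap K \<nu> (arm_at \<pi> (fst \<omega>) (snd \<omega>) (Suc s))) \<partial>bandit_space K \<nu>)"
proof -
  have "(\<Sum>t=1..T. f t) = (\<Sum>s<T. f (Suc s))" for f :: "nat \<Rightarrow> real"
    by (simp add: sum.atLeast1_atMost_eq)
  then show ?thesis by (simp add: regret_def gap_def)
qed

lemma regret_explore_only:
  assumes "explore_length K T = T"
  shows "regret K T \<nu> \<pi> = (\<Sum>s<T. gap K \<nu> (1 + s mod K))"
proof -
  interpret prob_space "bandit_space K \<nu>" by (rule prob_space_bandit)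
  show ?thesis
    unfolding regret_eq using adar_etc_arm_explore[OF adar] assms by (simp add: prob_space)
qed

text \<open>A measurable superset \<open>E\<close> of the deviation event, phrased through block
  sums, replaces that event itself. It serves all seeds \<open>w\<close> at once, because the
  exploration samples do not depend on the seed.\<close>

lemma estimate_deviation_prob:
  assumes "i \<in> {1..K}" and L: "explore_length K T < T" and r: "0 < r"
    and s: "40 * u \<le> real (explore_length K T div K div num_blocks K T) powr \<epsilon> * r powr (1 + \<epsilon>)"
  obtains E where "E \<in> sets (reward_table K \<nu>)"
    and "measure (reward_table K \<nu>) E \<le> (1 / 2) ^ nat \<lceil>real (num_blocks K T) / 2\<rceil>"
    and "\<And>w x. x \<in> space (reward_table K \<nu>) \<Longrightarrow>
      r < \<bar>median_of_means (num_blocks K T) (samples i (play \<pi> w x (explore_length K T)))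
          - arm_mean \<nu> i\<bar> \<Longrightarrow> x \<in> E"
proof -
  define B where "B = num_blocks K T"
  define L where "L = explore_length K T"
  define n where "n = card {s. s < L \<and> 1 + s mod K = i}"
  define s where "s = n div B"
  define m where "m = nat \<lceil>real B / 2\<rceil>"
  define E where "E = {x \<in> space (reward_table K \<nu>). m \<le> card {b. b < B \<and>
      r < \<bar>(\<Sum>l = b * s..<(b + 1) * s. x (i, l)) / real s - arm_mean \<nu> i\<bar>}}"
  have B: "0 < B" using num_blocks_bounds(1)[OF K T] by (simp add: B_def)
  have m: "0 < m" "B \<le> 2 * m" using B unfolding m_def by linarith+
  \<comment> \<open>The hypothesis on \<open>r\<close> uses a block size common to all arms; the
    true block size of arm \<open>i\<close> is at least as large, and \<open>powr \<epsilon>\<close>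
    is monotone.\<close>
  have le: "L div K div B \<le> s"
    unfolding s_def n_def by (intro div_le_mono card_residue_class(1) assms(1))
  moreover have "0 < L div K div B"
    using block_size_lower_bounds(1)[OF K T] L by (simp add: B_def L_def)
  ultimately have "0 < s" by linarith
  have "40 * u \<le> real (L div K div B) powr \<epsilon> * r powr (1 + \<epsilon>)" using s by (simp add: L_def B_def)
  also have "\<dots> \<le> real s powr \<epsilon> * r powr (1 + \<epsilon>)"
    using le eps by (intro mult_right_mono powr_mono2) auto
  \<comment> \<open>Multiplying by \<open>s\<close> completes the power
    \<open>(real s * r) powr (1 + \<epsilon>)\<close> required for the block deviations.\<close>
  finally have "real s * (40 * u) \<le> real s * (real s powr \<epsilon> * r powr (1 + \<epsilon>))"
    by (intro mult_left_mono) auto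
  also have "\<dots> = (real s * r) powr (1 + \<epsilon>)"
    using \<open>0 < s\<close> r by (simp add: powr_mult powr_add)
  finally have "40 * real s * u \<le> (real s * r) powr (1 + \<epsilon>)" by (simp add: mult_ac)
  note E = prob_many_block_deviations[OF ht assms(1) eps u r \<open>0 < s\<close> this m, folded E_def]
  show ?thesis
  proof (rule that[OF E(1) E(2)[unfolded m_def B_def]])
    fix w x assume x: "x \<in> space (reward_table K \<nu>)"
      and dev: "r < \<bar>median_of_means (num_blocks K T) (samples i (play \<pi> w x (explore_length K T)))
          - arm_mean \<nu> i\<bar>"
    define xs where "xs = samples i (play \<pi> w x L)"
    have xs: "xs = map (\<lambda>s. x (i, s)) [0..<n]"
      using adar_etc_samples[OF adar, of i w x] by (simp add: xs_def n_def L_def)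
    have "m \<le> card {b. b < B \<and> r < \<bar>block_mean B xs b - arm_mean \<nu> i\<bar>}"
      unfolding m_def
      by (rule median_of_means_deviation[OF _ B]) (use dev in \<open>simp add: xs_def B_def L_def\<close>)
    also have "{b. b < B \<and> r < \<bar>block_mean B xs b - arm_mean \<nu> i\<bar>} =
        {b. b < B \<and> r < \<bar>(\<Sum>l = b * s..<(b + 1) * s. x (i, l)) / real s - arm_mean \<nu> i\<bar>}"
      unfolding xs s_def by (intro Collect_cong conj_cong refl) (simp add: block_mean_map)
    finally show "x \<in> E" using x by (simp add: E_def)
  qed
qed

text \<open>The integrand of the regret is only bounded from above: since the bound is nonnegative, this
  suffices even if the integrand is not integrable.\<close>

lemma regret_le:
  assumes L: "explore_length K T < T" and r: "0 < r"
    and s: "40 * u \<le> real (explore_length K T div K div num_blocks K T) powr \<epsilon> * r powr (1 + \<epsilon>)"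
    and g: "0 \<le> g" "\<And>i. i \<in> {1..K} \<Longrightarrow> gap K \<nu> i \<le> 2 * r \<Longrightarrow> gap K \<nu> i \<le> g"
  shows "regret K T \<nu> \<pi> \<le> (\<Sum>s<explore_length K T. gap K \<nu> (1 + s mod K))
           + real T * g + 4 * u powr (1 / (1 + \<epsilon>))"
proof -
  define L where "L = explore_length K T"
  define D where "D = 4 * u powr (1 / (1 + \<epsilon>))"
  define m where "m = nat \<lceil>real (num_blocks K T) / 2\<rceil>"
  define S where "S = (\<Sum>s<L. gap K \<nu> (1 + s mod K))"
  define est where "est w x i = median_of_means (num_blocks K T) (samples i (play \<pi> w x L))"
    for w x i
  interpret prob_space "bandit_space K \<nu>" by (rule prob_space_bandit)
  interpret R: prob_space "reward_table K \<nu>" by (rule prob_space_reward_table[OF ht])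
  have LT: "L < T" using L by (simp add: L_def)
  have "\<forall>i\<in>{1..K}. \<exists>E. E \<in> sets (reward_table K \<nu>) \<and> measure (reward_table K \<nu>) E \<le> (1 / 2) ^ m \<and>
      (\<forall>w. \<forall>x\<in>space (reward_table K \<nu>). r < \<bar>est w x i - arm_mean \<nu> i\<bar> \<longrightarrow> x \<in> E)"
    using estimate_deviation_prob[OF _ L r s] unfolding est_def L_def m_def by metis
  then obtain E where E: "\<And>i. i \<in> {1..K} \<Longrightarrow> E i \<in> sets (reward_table K \<nu>)"
    "\<And>i. i \<in> {1..K} \<Longrightarrow> measure (reward_table K \<nu>) (E i) \<le> (1 / 2) ^ m"
    "\<And>i w x. i \<in> {1..K} \<Longrightarrow> x \<in> space (reward_table K \<nu>) \<Longrightarrow>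
      r < \<bar>est w x i - arm_mean \<nu> i\<bar> \<Longrightarrow> x \<in> E i"
    by metis
  define F where "F = {\<omega> \<in> space (bandit_space K \<nu>). snd \<omega> \<in> (\<Union>i\<in>{1..K}. E i)}"
  have EU: "(\<Union>i\<in>{1..K}. E i) \<in> sets (reward_table K \<nu>)" using E(1) by auto
  have F: "F \<in> events" unfolding F_def by (rule measure_bandit_snd(1)[OF EU])
  have "prob F = measure (reward_table K \<nu>) (\<Union>i\<in>{1..K}. E i)"
    unfolding F_def by (rule measure_bandit_snd(2)[OF EU])
  also have "\<dots> \<le> (\<Sum>i\<in>{1..K}. measure (reward_table K \<nu>) (E i))"
    using E(1) by (intro measure_UNION_le) auto
  also have "\<dots> \<le> (\<Sum>i\<in>{1..K}. (1 / 2) ^ m)" by (intro sum_mono E(2))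
  also have "\<dots> \<le> 1 / real T ^ 3"
    using half_power_num_blocks[OF K T] by (simp add: m_def)
  \<comment> \<open>At probability \<open>1 / T\<close>, up to \<open>T\<close> rounds of loss
    \<open>D\<close> on \<open>F\<close> cost at most \<open>D\<close> in expectation.\<close>
  also have "\<dots> \<le> 1 / real T" using T by (intro divide_left_mono self_le_power) auto
  finally have prob_F: "real T * prob F \<le> 1" using T by (simp add: field_simps)
  have D: "0 \<le> D" "\<And>i. i \<in> {1..K} \<Longrightarrow> gap K \<nu> i \<le> D"
    using gap_le[OF ht _ eps(1) u] by (auto simp: D_def)
  have K0: "1 + s mod K \<in> {1..K}" for s using K by (auto simp: Suc_le_eq)
  have S: "0 \<le> S" unfolding S_def by (intro sum_nonneg gap_nonneg K0)
  \<comment> \<open>The dominating function: exploration costs \<open>S\<close>, and each later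
    round costs at most \<open>g\<close>, with an extra \<open>D\<close> on the bad event
    \<open>F\<close>. The applications take \<open>g\<close> to be \<open>2 * r\<close> or
    \<open>0\<close>.\<close>
  define h where "h \<omega> = S + real T * (g + D * indicator F \<omega>)" for \<omega>
  have commit: "gap K \<nu> (arm_at \<pi> (fst \<omega>) (snd \<omega>) (Suc t)) \<le> g + D * indicator F \<omega>"
    if \<omega>: "\<omega> \<in> space (bandit_space K \<nu>)" and t: "t \<in> {L..<T}" for \<omega> t
  proof -
    define i where "i = arm_at \<pi> (fst \<omega>) (snd \<omega>) (Suc t)"
    have t': "explore_length K T \<le> t" "t < T" using t by (auto simp: L_def)
    have i: "i \<in> {1..K}" "\<And>j. j \<in> {1..K} \<Longrightarrow> est (fst \<omega>) (snd \<omega>) j \<le> est (fst \<omega>) (snd \<omega>) i"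
      using adar_etc_arm_commit[OF adar t', where w = "fst \<omega>" and x = "snd \<omega>"]
      unfolding i_def est_def L_def by blast+
    show ?thesis
    proof (cases "\<omega> \<in> F")
      case True
      then show ?thesis using D(2)[OF i(1)] g(1) by (simp add: i_def)
    next
      case False
      have "snd \<omega> \<in> space (reward_table K \<nu>)"
        using \<omega> unfolding bandit_space_eq[OF ht] by (auto simp: space_pair_measure)
      then have "\<bar>est (fst \<omega>) (snd \<omega>) j - arm_mean \<nu> j\<bar> \<le> r" if "j \<in> {1..K}" for j
        using False \<omega> that E(3)[OF that] by (force simp: F_def not_less[symmetric])
      then have "gap K \<nu> i \<le> 2 * r" by (rule gap_le_of_estimates[where f = "est (fst \<omega>) (snd \<omega>)", OF i(1) _ i(2)])
      then show ?thesis using g(2)[OF i(1)] False by (simp add: i_def)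
    qed
  qed
  have "regret K T \<nu> \<pi> \<le> expectation h"
    unfolding regret_eq
  proof (rule integral_mono')
    show "integrable (bandit_space K \<nu>) h"
      unfolding h_def using F
      by (intro Bochner_Integration.integrable_add integrable_mult_right integrable_const)
        (auto simp: emeasure_eq_measure)
  next
    fix \<omega> assume \<omega>: "\<omega> \<in> space (bandit_space K \<nu>)"
    show "0 \<le> h \<omega>" unfolding h_def using S g(1) D(1) by simp
    have "(\<Sum>t<T. gap K \<nu> (arm_at \<pi> (fst \<omega>) (snd \<omega>) (Suc t))) =
        (\<Sum>t<L. gap K \<nu> (arm_at \<pi> (fst \<omega>) (snd \<omega>) (Suc t))) +
        (\<Sum>t\<in>{L..<T}. gap K \<nu> (arm_at \<pi> (fst \<omega>) (snd \<omega>) (Suc t)))"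
      using LT by (simp flip: atLeast0LessThan add: sum.atLeastLessThan_concat)
    also have "(\<Sum>t<L. gap K \<nu> (arm_at \<pi> (fst \<omega>) (snd \<omega>) (Suc t))) = S"
      unfolding S_def using adar_etc_arm_explore[OF adar] by (simp add: L_def)
    also have "(\<Sum>t\<in>{L..<T}. gap K \<nu> (arm_at \<pi> (fst \<omega>) (snd \<omega>) (Suc t)))
        \<le> (\<Sum>t\<in>{L..<T}. g + D * indicator F \<omega>)"
      by (intro sum_mono commit \<omega>)
    also have "\<dots> \<le> real T * (g + D * indicator F \<omega>)"
      using g(1) D(1) by (simp add: mult_right_mono)
    finally show "(\<Sum>t<T. gap K \<nu> (arm_at \<pi> (fst \<omega>) (snd \<omega>) (Suc t))) \<le> h \<omega>"
      by (simp add: h_def)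
  qed
  also have "expectation h = S + real T * (g + D * prob F)"
    unfolding h_def using F by (simp add: prob_space emeasure_eq_measure)
  also have "\<dots> = S + real T * g + D * (real T * prob F)" by (simp add: algebra_simps)
  also have "\<dots> \<le> S + real T * g + D"
    using mult_left_mono[OF prob_F D(1)] by simp
  finally show ?thesis by (simp add: S_def L_def D_def)
qed

end

section \<open>The uniform bound over all instances\<close>

lemma powr_interpolation_mono:
  fixes k t :: real
  assumes "0 < k" "k \<le> t" "a \<le> b"
  shows "k powr b * t powr (1 - b) \<le> k powr a * t powr (1 - a)"
proof -
  \<comment> \<open>The expression is \<open>t * (k / t) powr b\<close> with
    \<open>k / t \<le> 1\<close>, hence decreasing in \<open>b\<close>; concretely,
    \<open>k powr (b - a)\<close> is traded for \<open>t powr (b - a)\<close>.\<close>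
  have "k powr b * t powr (1 - b) = k powr a * k powr (b - a) * t powr (1 - b)"
    by (simp flip: powr_add)
  also have "\<dots> \<le> k powr a * t powr (b - a) * t powr (1 - b)"
    using assms by (intro mult_right_mono mult_left_mono powr_mono2) auto
  also have "\<dots> = k powr a * t powr (1 - a)" by (simp add: mult.assoc flip: powr_add)
  finally show ?thesis .
qed

text \<open>Exploration, misidentification and the bad event are each bounded by a multiple of
  \<open>v * B * G\<close>, where \<open>G\<close> is the claimed rate in \<open>K\<close> and
  \<open>T\<close>. The single logarithmic factor comes from \<open>B\<close>.\<close>

lemma regret_minimax_bound:
  assumes ht: "\<nu> \<in> heavy_tailed \<epsilon> u K" and K: "2 \<le> K" and KT: "K \<le> T"
    and eps: "0 < \<epsilon>" "\<epsilon> \<le> 1" and u: "0 < u" and adar: "adar_etc K T \<pi>"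
  shows "regret K T \<nu> \<pi> \<le> 4000 * (1 + ln (real K * real T)) * u powr (1 / (1 + \<epsilon>)) *
    real K powr (2 * \<epsilon> / (3 * (1 + \<epsilon>))) * real T powr ((3 + \<epsilon>) / (3 * (1 + \<epsilon>)))"
proof -
  \<comment> \<open>The exponents of \<open>K\<close> and \<open>T\<close> in the claim sum to 1, so
    \<open>G\<close> interpolates between \<open>K\<close> and \<open>T\<close>. As
    \<open>a \<le> 1 / 3\<close>, it dominates both summands of the exploration length, which have
    exponents 1 and 1/3 of \<open>K\<close>.\<close>
  define a where "a = 2 * \<epsilon> / (3 * (1 + \<epsilon>))"
  define G where "G = real K powr a * real T powr (1 - a)"
  define B where "B = real (num_blocks K T)"
  define l where "l = 1 + ln (real K * real T)"
  define v where "v = u powr (1 / (1 + \<epsilon>))"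
  define L where "L = explore_length K T"
  have T: "1 \<le> T" using K KT by simp
  have pos: "0 < real K" "real K \<le> real T" "0 < v" "0 < real T" using K KT u by (auto simp: v_def)
  have a: "0 < a" "a \<le> 1 / 3" using eps by (auto simp: a_def field_simps)
  have "(3 + \<epsilon>) / (3 * (1 + \<epsilon>)) = 1 - a" using eps by (simp add: a_def field_simps)
  then have goal: "real K powr (2 * \<epsilon> / (3 * (1 + \<epsilon>))) * real T powr ((3 + \<epsilon>) / (3 * (1 + \<epsilon>))) = G"
    by (simp add: G_def a_def)
  have G1: "real K \<le> G"
    using powr_interpolation_mono[of "real K" "real T" a 1] pos a by (simp add: G_def)
  have G2: "real K powr (1/3) * real T powr (2/3) \<le> G"
    using powr_interpolation_mono[of "real K" "real T" a "1/3"] pos a by (simp add: G_def)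
  have G3: "1 \<le> G" using G1 K by linarith
  have B: "1 \<le> B" "B \<le> 24 * l"
    using num_blocks_bounds[OF K T] by (auto simp: B_def l_def)
  have "0 \<le> ln (real K * real T)" using K T by (simp add: ln_mult)
  then have l: "1 \<le> l" by (simp add: l_def)
  have "real K * B \<le> G * B" using G1 B by (intro mult_right_mono) auto
  then have L: "real L \<le> G * (B + 2)"
    using explore_length_le[of K T] G2 G3 by (simp add: L_def B_def algebra_simps)
  have "1 + s mod K \<in> {1..K}" for s using K by (auto simp: Suc_le_eq)
  then have "(\<Sum>s<n. gap K \<nu> (1 + s mod K)) \<le> (\<Sum>s<n. 4 * v)" for n
    unfolding v_def by (intro sum_mono gap_le[OF ht _ eps(1) u])
  then have explore: "(\<Sum>s<L. gap K \<nu> (1 + s mod K)) \<le> 4 * v * (G * (B + 2))"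
    using mult_left_mono[OF L, of "4 * v"] pos by (simp add: algebra_simps) (meson order_trans)
  have "regret K T \<nu> \<pi> \<le> 4 * v * (G * (B + 3)) + 160 * v * B * G"
  proof (cases "L < T")
    case False
    then have "L = T" by (simp add: L_def explore_length_def)
    then have "regret K T \<nu> \<pi> \<le> 4 * v * (G * (B + 2))"
      using regret_explore_only[OF ht K T eps u adar] explore by (simp add: L_def)
    also have "\<dots> \<le> 4 * v * (G * (B + 3))" using pos G3 by simp
    also have "\<dots> \<le> 4 * v * (G * (B + 3)) + 160 * v * B * G" using pos G3 B by simp
    finally show ?thesis .
  next
    case True
    define s where "s = real (L div K div num_blocks K T)"
    define p where "p = \<epsilon> / (1 + \<epsilon>)"
    define y where "y = real K powr (-2/3) * real T powr (2/3)"
    \<comment> \<open>The smallest radius with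
      \<open>40 * u \<le> s powr \<epsilon> * r powr (1 + \<epsilon>)\<close>.\<close>
    define r where "r = (40 * u) powr (1 / (1 + \<epsilon>)) * s powr (- p)"
    have s: "0 < s" "y / B \<le> 2 * s"
      using block_size_lower_bounds[OF K T] True by (auto simp: s_def L_def y_def B_def)
    have p: "0 < p" "p \<le> 1" using eps by (auto simp: p_def field_simps)
    have y: "0 < y" using pos by (simp add: y_def)
    have r: "0 < r" using s u by (simp add: r_def)
    have "r powr (1 + \<epsilon>) = 40 * u * s powr (- \<epsilon>)"
      using eps u s by (simp add: r_def p_def powr_mult powr_powr)
    then have "40 * u \<le> s powr \<epsilon> * r powr (1 + \<epsilon>)"
      using s by (simp add: powr_minus field_simps)
    then have "regret K T \<nu> \<pi> \<le> (\<Sum>s<L. gap K \<nu> (1 + s mod K)) + real T * (2 * r) + 4 * v"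
      unfolding L_def v_def using True r
      by (intro regret_le[OF ht K T eps u adar]) (auto simp: L_def s_def)
    moreover have "4 * v \<le> 4 * v * G" using pos G3 by simp
    moreover have "real T * (2 * r) \<le> 160 * v * B * G"
    proof -
      have "(40 * u) powr (1 / (1 + \<epsilon>)) = 40 powr (1 / (1 + \<epsilon>)) * v"
        using u by (simp add: powr_mult v_def)
      also have "\<dots> \<le> 40 powr 1 * v"
        using pos eps by (intro mult_right_mono powr_mono) auto
      finally have r1: "(40 * u) powr (1 / (1 + \<epsilon>)) \<le> 40 * v" by simp
      have "y / (2 * B) \<le> s" using s B by (simp add: field_simps)
      then have "s powr (- p) \<le> (y / (2 * B)) powr (- p)"
        using p y B by (intro powr_mono2') auto
      also have "\<dots> = (2 * B) powr p * y powr (- p)"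
        using y B by (simp add: powr_divide powr_minus field_simps)
      also have "\<dots> \<le> (2 * B) powr 1 * y powr (- p)"
        using p B by (intro mult_right_mono powr_mono) auto
      finally have r2: "s powr (- p) \<le> 2 * B * y powr (- p)" using B by simp
      \<comment> \<open>Misidentification produces the exact rate since
        \<open>(2 / 3) * p = a\<close>.\<close>
      have Ty: "real T * y powr (- p) = G"
      proof -
        have "y powr (- p) = real K powr a * real T powr (- a)"
          using pos by (simp add: y_def powr_mult powr_powr a_def p_def)
        moreover have "real T * real T powr (- a) = real T powr (1 - a)"
          using pos by (simp add: powr_diff powr_minus field_simps)
        ultimately show ?thesis by (simp add: G_def)
      qed
      have "r \<le> 40 * v * (2 * B * y powr (- p))"
        unfolding r_def using r1 r2 pos by (intro mult_mono) auto
      then have "real T * (2 * r) \<le> real T * (2 * (40 * v * (2 * B * y powr (- p))))"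
        by (intro mult_left_mono) auto
      also have "\<dots> = 160 * v * B * (real T * y powr (- p))" by simp
      finally show ?thesis unfolding Ty .
    qed
    ultimately show ?thesis using explore by (simp add: algebra_simps)
  qed
  also have "\<dots> = v * G * (164 * B + 12)" by (simp add: algebra_simps)
  \<comment> \<open>From \<open>B \<le> 24 * l\<close> and \<open>1 \<le> l\<close> the coefficient
    is at most 164 * 24 + 12 = 3948.\<close>
  also have "\<dots> \<le> v * G * (4000 * l)" using B l pos G3 by (intro mult_left_mono) auto
  finally show ?thesis
    unfolding mult.assoc goal by (simp add: l_def v_def mult_ac)
qed

section \<open>The asymptotic bound for a fixed instance\<close>

lemma regret_limsup_bound:
  fixes \<pi> :: "nat \<Rightarrow> policy"
  assumes ht: "\<nu> \<in> heavy_tailed \<epsilon> u K" and K: "2 \<le> K"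
    and eps: "0 < \<epsilon>" "\<epsilon> \<le> 1" and u: "0 < u" and adar: "\<And>T. 1 \<le> T \<Longrightarrow> adar_etc K T (\<pi> T)"
  shows "limsup (\<lambda>T. ereal (regret K T \<nu> (\<pi> T) / (real K powr (-2/3) * real T powr (2/3))))
    \<le> ereal (\<Sum>i\<in>{i\<in>{1..K}. 0 < gap K \<nu> i}. gap K \<nu> i)"
proof -
  define S where "S = (\<Sum>i\<in>{1..K}. gap K \<nu> i)"
  define D where "D = 4 * u powr (1 / (1 + \<epsilon>))"
  define y where "y T = real K powr (-2/3) * real T powr (2/3)" for T :: nat
  \<comment> \<open>Every positive gap is at least \<open>3 * r\<close>, so an arm with gap at most
    \<open>2 * r\<close> is optimal and a good estimate leads to no regret. The inserted 1 covers an
    instance without positive gaps.\<close>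
  define r where "r = Min (insert 1 (gap K \<nu> ` {i \<in> {1..K}. 0 < gap K \<nu> i})) / 3"
  have fin: "finite (insert 1 (gap K \<nu> ` {i \<in> {1..K}. 0 < gap K \<nu> i}))" by auto
  have k: "0 < real K" using K by simp
  have "S = (\<Sum>i\<in>{i\<in>{1..K}. 0 < gap K \<nu> i}. gap K \<nu> i)"
    unfolding S_def
  proof (intro sum.mono_neutral_right ballI)
    fix i assume "i \<in> {1..K} - {i\<in>{1..K}. 0 < gap K \<nu> i}"
    then show "gap K \<nu> i = 0" using gap_nonneg[of i K \<nu>] by simp
  qed auto
  note S = this[symmetric]
  have "0 \<le> S" unfolding S_def by (intro sum_nonneg gap_nonneg)
  have r: "0 < r" using fin by (auto simp: r_def)
  have small_gap: "gap K \<nu> i \<le> 0" if "i \<in> {1..K}" "gap K \<nu> i \<le> 2 * r" for i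
  proof (rule ccontr)
    assume "\<not> gap K \<nu> i \<le> 0"
    then have "3 * r \<le> gap K \<nu> i" unfolding r_def using that fin by (auto intro!: Min_le)
    then show False using that r by linarith
  qed
  define l where "l T = 24 * (1 + ln (real K * real T))" for T :: nat
  \<comment> \<open>The block size from which the fixed radius \<open>r\<close> is
    admissible.\<close>
  define c where "c = (40 * u / r powr (1 + \<epsilon>)) powr (1 / \<epsilon>)"
  \<comment> \<open>For large \<open>T\<close> the exploration ends before the horizon, by
    \<open>ev1\<close>, and its blocks reach the size \<open>c\<close>, by \<open>ev2\<close>. In
    \<open>lim\<close> the logarithm and the constant \<open>D\<close> are negligible against
    \<open>y\<close>.\<close>
  have ev1: "\<forall>\<^sub>F T in sequentially. real K * l T + real K powr (1/3) * real T powr (2/3) + 1 < real T"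
    unfolding l_def using k by real_asymp
  have ev2: "\<forall>\<^sub>F T in sequentially. 2 * c \<le> y T / l T"
    unfolding l_def y_def using k by real_asymp
  have lim: "(\<lambda>T. ((l T + 2) / y T + 1) * S + D / y T) \<longlonglongrightarrow> S"
    unfolding l_def y_def using k by real_asymp
  have "\<forall>\<^sub>F T in sequentially. ereal (regret K T \<nu> (\<pi> T) / y T) \<le>
      ereal (((l T + 2) / y T + 1) * S + D / y T)"
    using ev1 ev2 eventually_ge_at_top[of 1]
  proof eventually_elim
    case (elim T)
    define L where "L = explore_length K T"
    define B where "B = real (num_blocks K T)"
    have T: "1 \<le> T" by (rule elim(3))
    have B: "0 < B" "B \<le> l T" using num_blocks_bounds[OF K T] by (auto simp: B_def l_def)
    have y: "0 < y T" using k T by (simp add: y_def)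
    have Lle: "real L \<le> real K * B + real K powr (1/3) * real T powr (2/3) + 1"
      using explore_length_le[of K T] by (simp add: L_def B_def)
    also have "\<dots> \<le> real K * l T + real K powr (1/3) * real T powr (2/3) + 1"
      using B k by simp
    finally have LT: "L < T" using elim(1) by simp
    define s where "s = real (L div K div num_blocks K T)"
    have "2 * c \<le> y T / l T" by (rule elim(2))
    also have "\<dots> \<le> y T / B" using B y by (intro divide_left_mono) auto
    also have "\<dots> \<le> 2 * s"
      using block_size_lower_bounds(2)[OF K T] LT by (simp add: s_def L_def y_def B_def)
    finally have "c powr \<epsilon> \<le> s powr \<epsilon>"
      using eps by (intro powr_mono2) (auto simp: c_def)
    then have "40 * u / r powr (1 + \<epsilon>) \<le> s powr \<epsilon>"
      using eps u r by (simp add: c_def powr_powr)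
    then have "40 * u \<le> s powr \<epsilon> * r powr (1 + \<epsilon>)" using r by (simp add: field_simps)
    then have "regret K T \<nu> (\<pi> T) \<le> (\<Sum>s<L. gap K \<nu> (1 + s mod K)) + real T * 0 + D"
      unfolding L_def D_def using LT r small_gap
      by (intro regret_le[OF ht K T eps u adar[OF T]]) (auto simp: L_def s_def)
    also have "(\<Sum>s<L. gap K \<nu> (1 + s mod K)) \<le> real (L div K + 1) * S"
      unfolding S_def using K by (intro sum_round_robin_le gap_nonneg) auto
    \<comment> \<open>Each arm is pulled about \<open>y T\<close> times, which yields the leading
      constant \<open>S\<close>; block count and rounding go into \<open>l T + 2\<close>.\<close>
    also have "real (L div K + 1) * S \<le> (l T + 2 + y T) * S"
    proof (rule mult_right_mono)
      have "real K powr (1/3) = real K powr 1 * real K powr (-2/3)"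
        unfolding powr_add[symmetric] by simp
      then have "real L \<le> real K * (B + y T) + 1"
        using Lle by (simp add: y_def distrib_left)
      also have "\<dots> \<le> real K * (B + y T + 1)" using K by (simp add: distrib_left)
      finally have "real L / real K \<le> B + y T + 1" using k by (simp add: field_simps)
      then have "real (L div K) \<le> B + y T + 1"
        using floor_divide_of_nat_eq[of L K, where 'a = real] by linarith
      then show "real (L div K + 1) \<le> l T + 2 + y T" using B by simp
    qed (rule \<open>0 \<le> S\<close>)
    finally have "regret K T \<nu> (\<pi> T) \<le> (l T + 2 + y T) * S + D" by simp
    then have "regret K T \<nu> (\<pi> T) / y T \<le> ((l T + 2 + y T) * S + D) / y T"
      using y by (intro divide_right_mono) auto
    also have "\<dots> = ((l T + 2) / y T + 1) * S + D / y T"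
      using y by (simp add: field_simps)
    finally show ?case by simp
  qed
  then have "limsup (\<lambda>T. ereal (regret K T \<nu> (\<pi> T) / y T)) \<le>
      limsup (\<lambda>T. ereal (((l T + 2) / y T + 1) * S + D / y T))"
    by (rule Limsup_mono)
  also have "\<dots> = ereal S"
    using lim by (intro lim_imp_Limsup) auto
  finally show ?thesis unfolding S y_def .
qed

theorem theorem7:
  fixes \<epsilon> :: real
  assumes "0 < \<epsilon>" and "\<epsilon> \<le> 1"
  shows "(\<exists>C m :: real. 0 < C \<and> 0 < m \<and>
            (\<forall>(u :: real) (K :: nat) (T :: nat) (\<nu> :: nat \<Rightarrow> real measure) (\<pi> :: policy).
               0 < u \<longrightarrow> 2 \<le> K \<longrightarrow> K \<le> T \<longrightarrow> \<nu> \<in> heavy_tailed \<epsilon> u K \<longrightarrow> adar_etc K T \<pi> \<longrightarrow>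
               regret K T \<nu> \<pi> \<le>
                 C * (1 + ln (real K * real T)) powr m * u powr (1 / (1 + \<epsilon>)) *
                 real K powr (2 * \<epsilon> / (3 * (1 + \<epsilon>))) *
                 real T powr ((3 + \<epsilon>) / (3 * (1 + \<epsilon>))))) \<and>
         (\<forall>(u :: real) (K :: nat) (\<nu> :: nat \<Rightarrow> real measure) (\<pi> :: nat \<Rightarrow> policy).
            0 < u \<longrightarrow> 2 \<le> K \<longrightarrow> \<nu> \<in> heavy_tailed \<epsilon> u K \<longrightarrow> (\<forall>T\<ge>1. adar_etc K T (\<pi> T)) \<longrightarrow>
            limsup (\<lambda>T. ereal (regret K T \<nu> (\<pi> T) / (real K powr (-2/3) * real T powr (2/3))))
              \<le> ereal (\<Sum>i\<in>{i\<in>{1..K}. 0 < gap K \<nu> i}. gap K \<nu> i))"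
proof (intro conjI)
  show "\<exists>C m :: real. 0 < C \<and> 0 < m \<and>
            (\<forall>(u :: real) (K :: nat) (T :: nat) (\<nu> :: nat \<Rightarrow> real measure) (\<pi> :: policy).
               0 < u \<longrightarrow> 2 \<le> K \<longrightarrow> K \<le> T \<longrightarrow> \<nu> \<in> heavy_tailed \<epsilon> u K \<longrightarrow> adar_etc K T \<pi> \<longrightarrow>
               regret K T \<nu> \<pi> \<le>
                 C * (1 + ln (real K * real T)) powr m * u powr (1 / (1 + \<epsilon>)) *
                 real K powr (2 * \<epsilon> / (3 * (1 + \<epsilon>))) *
                 real T powr ((3 + \<epsilon>) / (3 * (1 + \<epsilon>))))"
  \<comment> \<open>The same two constants work for every \<epsilon>, with the logarithm to the
    first power.\<close>
  proof (rule exI[of _ 4000], rule exI[of _ 1], intro conjI allI impI)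
    fix u :: real and K T :: nat and \<nu> :: "nat \<Rightarrow> real measure" and \<pi> :: policy
    assume *: "0 < u" "2 \<le> K" "K \<le> T" "\<nu> \<in> heavy_tailed \<epsilon> u K" "adar_etc K T \<pi>"
    \<comment> \<open>This makes the base \<open>1 + ln (real K * real T)\<close> nonnegative, so
      that \<open>powr 1\<close> leaves it unchanged.\<close>
    then have "0 \<le> ln (real K * real T)" by (simp add: ln_mult)
    then show "regret K T \<nu> \<pi> \<le>
        4000 * (1 + ln (real K * real T)) powr 1 * u powr (1 / (1 + \<epsilon>)) *
        real K powr (2 * \<epsilon> / (3 * (1 + \<epsilon>))) * real T powr ((3 + \<epsilon>) / (3 * (1 + \<epsilon>)))"
      using regret_minimax_bound[OF *(4,2,3) assms *(1,5)] by simp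
  qed simp_all
qed (intro allI impI, rule regret_limsup_bound[OF _ _ assms], simp_all)

end
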